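(* Let $a,b\in\mathbb{Z}$ be such that $x^3-ax+b$ is irreducible over $\mathbb{Q}$ and such that for every prime number $p$ one has $v_p(a)<2$ or $v_p(b)<3$. Let $\mathbb{K}=\mathbb{Q}(\theta)$ where $\theta^3-a\theta+b=0$. Put $\Delta=4a^3-27b^2$, $s_3=v_3(\Delta)$ and $\Delta_3=\Delta/3^{s_3}$. Then $$i(\mathbb{K})=2^{\alpha}3^{\beta},$$ where $$\alpha=\begin{cases}1 & \text{if } 1=v_2(a)<v_2(b)\ \text{ or }\ a\not\equiv b \pmod 2,\\ 0&\text{otherwise,}\end{cases}$$ and $$\beta=\begin{cases}1 & \text{if } \big(a\equiv 3 \pmod 9,\ b^2\equiv a+1 \pmod{27},\ s_3>6 \text{ is even, and } \Delta_3\equiv 1\pmod 3\big)\\ & \text{or } \big(a\equiv 1\pmod 3 \text{ and } 3\mid b\big),\\ 0&\text{otherwise.}\end{cases}$$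
   Context: For a prime $p$, $v_p$ denotes the $p$-adic valuation on $\mathbb{Q}$, with $v_p(0)=\infty$. For a number field $\mathbb{K}$ of degree $n$ over $\mathbb{Q}$ with ring of integers $\mathbb{A}$, let $\widehat{\mathbb{A}}$ be the set of $\theta\in\mathbb{A}$ that are primitive over $\mathbb{Q}$, i.e. $\mathbb{K}=\mathbb{Q}(\theta)$. For $\theta\in\mathbb{A}$ let $F_\theta(x)\in\mathbb{Z}[x]$ be the (degree $n$) characteristic polynomial of $\theta$ over $\mathbb{Q}$ and set $i(\theta)=\gcd_{x\in\mathbb{Z}}F_\theta(x)$. Define $i(\mathbb{K})=\operatorname{lcm}_{\theta\in\widehat{\mathbb{A}}}\, i(\theta)$. *)

theory Defs
  imports
    "HOL-Library.Extended_Nat"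
    "HOL-Number_Theory.Cong"
    "Jordan_Normal_Form.Char_Poly"
begin

text \<open>The \<open>p\<close>-adic valuation, restricted to the integers, where its values are natural numbers
  or \<open>\<infinity>\<close>. The case distinction is needed because \<open>multiplicity p 0 = 0\<close>.\<close>

definition vp :: "nat \<Rightarrow> int \<Rightarrow> enat" where
  "vp p m = (if m = 0 then \<infinity> else enat (multiplicity (int p) m))"

text \<open>Number fields are sets \<open>K\<close> inside an arbitrary ambient field of characteristic 0.\<close>

definition is_subfield :: "'a::field_char_0 set \<Rightarrow> bool" where
  "is_subfield K \<longleftrightarrow> 0 \<in> K \<and> 1 \<in> K \<and>
     (\<forall>x\<in>K. \<forall>y\<in>K. x - y \<in> K \<and> x * y \<in> K) \<and> (\<forall>x\<in>K. inverse x \<in> K)"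

definition rat_adjoin :: "'a::field_char_0 \<Rightarrow> 'a set" where
  "rat_adjoin \<theta> = is_subfield hull {\<theta>}"

definition ring_of_integers :: "'a::field_char_0 set \<Rightarrow> 'a set" where
  "ring_of_integers K = {\<theta> \<in> K. algebraic_int \<theta>}"

definition primitive_integers :: "'a::field_char_0 set \<Rightarrow> 'a set" where
  "primitive_integers K = {\<theta> \<in> ring_of_integers K. K = rat_adjoin \<theta>}"

definition rat_scale :: "rat \<Rightarrow> 'a::field_char_0 \<Rightarrow> 'a" where
  "rat_scale q x = of_rat q * x"

global_interpretation rat_vs: vector_space rat_scale
  by unfold_locales (simp_all add: rat_scale_def algebra_simps of_rat_add of_rat_mult)

definition is_rat_basis :: "'a::field_char_0 set \<Rightarrow> 'a list \<Rightarrow> bool" where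
  "is_rat_basis K bs \<longleftrightarrow>
     distinct bs \<and> rat_vs.independent (set bs) \<and> rat_vs.span (set bs) = K"

text \<open>\<open>M\<close> is the matrix, with respect to the basis \<open>bs\<close>, of the \<open>\<rat>\<close>-linear map \<open>x \<mapsto> \<theta> x\<close>.\<close>

definition is_mult_mat :: "'a::field_char_0 list \<Rightarrow> 'a \<Rightarrow> rat mat \<Rightarrow> bool" where
  "is_mult_mat bs \<theta> M \<longleftrightarrow>
     M \<in> carrier_mat (length bs) (length bs) \<and>
     (\<forall>j<length bs. \<theta> * bs ! j = (\<Sum>i<length bs. rat_scale (M $$ (i, j)) (bs ! i)))"

text \<open>The characteristic polynomial over \<open>\<rat>\<close> of an integer \<open>\<theta>\<close> of the number field \<open>K\<close>, as a
  polynomial with integer coefficients. It does not depend on the basis, so the description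
  is definite; it is meaningful only for \<open>\<theta> \<in> ring_of_integers K\<close> and \<open>K\<close> of finite degree.\<close>

definition field_char_poly :: "'a::field_char_0 set \<Rightarrow> 'a \<Rightarrow> int poly" where
  "field_char_poly K \<theta> =
     (THE F. \<exists>bs M. is_rat_basis K bs \<and> is_mult_mat bs \<theta> M \<and> map_poly of_int F = char_poly M)"

definition value_gcd :: "'a::field_char_0 set \<Rightarrow> 'a \<Rightarrow> int" where
  "value_gcd K \<theta> = Gcd (range (poly (field_char_poly K \<theta>)))"

text \<open>Each \<open>value_gcd K \<theta>\<close> divides \<open>n!\<close> for \<open>n\<close> the degree of \<open>K\<close>, so the set below is finite and
  \<open>Lcm\<close> does not take its default value 0 on infinite sets.\<close>

definition field_value_lcm :: "'a::field_char_0 set \<Rightarrow> int" where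
  "field_value_lcm K = Lcm (value_gcd K ` primitive_integers K)"

end

theory Submission
  imports
    Defs
    "HOL-Computational_Algebra.Polynomial_Factorial"
    "HOL-Computational_Algebra.Field_as_Ring"
begin

text \<open>The third difference of a monic cubic is 6, so every \<open>i(\<eta>)\<close> divides 6 and only the primes 2 and 3
  matter. If \<open>F\<^sub>\<eta>\<close> has a simple root modulo \<open>p\<close>, Hensel lifting gives \<open>p\<close>-adic approximate roots
  of \<open>F\<^sub>\<eta>\<close>; writing \<open>\<theta>\<close> as a rational polynomial in \<open>\<eta>\<close> transports them to approximate roots of
  \<open>x\<^sup>3 - a x + b\<close>. For \<open>p = 2\<close> these are excluded modulo 8 unless \<open>\<alpha> = 1\<close>. For \<open>p = 3\<close> one has
  \<open>F\<^sub>\<eta> \<equiv> x\<^sup>3 - x\<close> modulo 3, so \<open>disc F\<^sub>\<eta> \<equiv> 1\<close>; as \<open>\<Delta>\<close> differs from it by a rational square, \<open>s\<^sub>3\<close> is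
  even and \<open>\<Delta>\<^sub>3 \<equiv> 1\<close>, and an approximate root modulo 81 then forces the remaining conditions.
  Conversely, \<open>\<theta>\<close>, \<open>\<theta> + \<theta>\<^sup>2\<close>, \<open>\<theta>\<^sup>2 / 2\<close> or a suitable \<open>- D / (\<theta> - \<rho>)\<close> attains each prime.\<close>

section \<open>Cubic extensions of the rationals inside a field\<close>

lemma is_subfieldD:
  assumes "is_subfield K"
  shows "0 \<in> K" "1 \<in> K" "x \<in> K \<Longrightarrow> y \<in> K \<Longrightarrow> x - y \<in> K" "x \<in> K \<Longrightarrow> y \<in> K \<Longrightarrow> x * y \<in> K"
    "x \<in> K \<Longrightarrow> inverse x \<in> K" "x \<in> K \<Longrightarrow> - x \<in> K" "x \<in> K \<Longrightarrow> y \<in> K \<Longrightarrow> x + y \<in> K"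
    "x \<in> K \<Longrightarrow> y \<in> K \<Longrightarrow> x / y \<in> K"
proof -
  show *: "0 \<in> K" "1 \<in> K" "\<And>x y. x \<in> K \<Longrightarrow> y \<in> K \<Longrightarrow> x - y \<in> K"
    "\<And>x y. x \<in> K \<Longrightarrow> y \<in> K \<Longrightarrow> x * y \<in> K" "\<And>x. x \<in> K \<Longrightarrow> inverse x \<in> K"
    using assms by (auto simp: is_subfield_def)
  show neg: "- x \<in> K" if "x \<in> K" for x using *(3)[OF *(1) that] by simp
  show "x + y \<in> K" if "x \<in> K" "y \<in> K" for x y using *(3)[OF that(1) neg[OF that(2)]] by simp
  show "x / y \<in> K" if "x \<in> K" "y \<in> K" for x y
    using *(4)[OF that(1) *(5)[OF that(2)]] by (simp add: divide_inverse)
qed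

lemma is_subfield_of_int:
  assumes "is_subfield K"
  shows "of_int n \<in> K"
proof -
  have "of_nat m \<in> K" for m
    by (induction m) (auto intro: is_subfieldD[OF assms])
  then show ?thesis
    by (cases n rule: int_cases2) (auto intro: is_subfieldD[OF assms])
qed

lemma is_subfield_of_rat:
  assumes "is_subfield K"
  shows "of_rat x \<in> K"
  by (cases x) (auto simp: of_rat_rat intro!: is_subfieldD[OF assms] is_subfield_of_int[OF assms])

lemma is_subfield_Rats: "is_subfield (\<rat> :: 'a::field_char_0 set)"
  by (auto simp: is_subfield_def)

lemma is_subfield_rat_adjoin: "is_subfield (rat_adjoin x)"
  unfolding rat_adjoin_def by (rule hull_in) (auto simp: is_subfield_def)

lemma in_rat_adjoin_self: "x \<in> rat_adjoin x"
  unfolding rat_adjoin_def using hull_subset[of "{x}"] by blast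

lemma rat_adjoin_minimal: "is_subfield K \<Longrightarrow> x \<in> K \<Longrightarrow> rat_adjoin x \<subseteq> K"
  unfolding rat_adjoin_def by (rule hull_minimal) auto

lemma quadratic_poly_eq:
  fixes g :: "'b::comm_semiring_0 poly"
  assumes "degree g < 3"
  shows "g = [:coeff g 0, coeff g 1, coeff g 2:]"
proof (rule poly_eqI)
  fix n
  show "coeff g n = coeff [:coeff g 0, coeff g 1, coeff g 2:] n"
  proof (cases "n < 3")
    case True
    then consider "n = 0" | "n = 1" | "n = 2" by linarith
    then show ?thesis by cases (auto simp: eval_nat_numeral)
  next
    case False
    then show ?thesis using assms by (simp add: coeff_eq_0 coeff_pCons split: nat.splits)
  qed
qed

section \<open>The field \<open>K\<close> in coordinates with respect to
  \<open>1, \<theta>, \<theta>\<^sup>2\<close>\<close>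

locale cubic_field =
  fixes a b :: int and \<theta> :: "'a::field_char_0" and K :: "'a set"
  assumes irr: "irreducible ([:of_int b, - of_int a, 0, 1:] :: rat poly)"
    and root: "\<theta> ^ 3 - of_int a * \<theta> + of_int b = 0"
    and K: "K = rat_adjoin \<theta>"
begin

definition elt :: "rat \<Rightarrow> rat \<Rightarrow> rat \<Rightarrow> 'a" where
  "elt p q r = of_rat p + of_rat q * \<theta> + of_rat r * \<theta>\<^sup>2"

definition min_cubic :: "rat poly" where "min_cubic = [:of_int b, - of_int a, 0, 1:]"

abbreviation ev :: "rat poly \<Rightarrow> 'a" where "ev g \<equiv> poly (map_poly of_rat g) \<theta>"

lemma ev_min_cubic: "ev min_cubic = 0"
  using root by (simp add: min_cubic_def of_rat_minus algebra_simps power3_eq_cube hom_distribs)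

lemma ev_add: "ev (g + h) = ev g + ev h"
  and ev_mult: "ev (g * h) = ev g * ev h"
proof -
  interpret h: map_poly_comm_ring_hom "of_rat :: rat \<Rightarrow> 'a" ..
  show "ev (g + h) = ev g + ev h" "ev (g * h) = ev g * ev h" by (simp_all add: hom_distribs)
qed

lemma ev_small: "ev [:p, q, r:] = elt p q r"
  by (simp add: elt_def algebra_simps power2_eq_square hom_distribs)

text \<open>Division by \<open>min_cubic\<close>, which vanishes at \<theta>, leaves a remainder of
  degree at most 2 with the same value.\<close>

lemma ev_eq_elt: "\<exists>p q r. ev g = elt p q r"
proof -
  have f0: "min_cubic \<noteq> 0" "degree min_cubic = 3" by (auto simp: min_cubic_def)
  have "ev g = ev (g div min_cubic * min_cubic + g mod min_cubic)" by (simp only: div_mult_mod_eq)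
  also have "\<dots> = ev (g mod min_cubic)" unfolding ev_add ev_mult ev_min_cubic by simp
  also have "degree (g mod min_cubic) < 3" using degree_mod_less[OF f0(1), of g] f0 by auto
  from quadratic_poly_eq[OF this] have "ev (g mod min_cubic) = elt (coeff (g mod min_cubic) 0) (coeff (g mod min_cubic) 1) (coeff (g mod min_cubic) 2)"
    using ev_small by metis
  finally show ?thesis by blast
qed

text \<open>An irreducible cubic is coprime to every nonzero polynomial of smaller degree, so a
  Bezout identity evaluated at \<theta> yields the inverse. Both the uniqueness of coordinates and
  the closure of the elements \<open>elt p q r\<close> under inversion rest on this.\<close>

lemma small_inverse:
  assumes "g \<noteq> 0" "degree g < 3"
  obtains h where "ev h * ev g = 1"
proof -
  have irf: "irreducible min_cubic" using irr by (simp add: min_cubic_def)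
  have "\<not> min_cubic dvd g"
    using dvd_imp_degree_le[of min_cubic g] assms by (auto simp: min_cubic_def)
  then have "coprime min_cubic g"
    using field_poly_irreducible_imp_prime[OF irf] by (simp add: prime_elem_imp_coprime)
  then have "fst (bezout_coefficients min_cubic g) * min_cubic + snd (bezout_coefficients min_cubic g) * g = 1"
    using bezout_coefficients_fst_snd[of min_cubic g] by simp
  then have "ev (fst (bezout_coefficients min_cubic g) * min_cubic + snd (bezout_coefficients min_cubic g) * g) = 1"
    by simp
  then show ?thesis using that unfolding ev_add ev_mult ev_min_cubic by simp
qed

lemma elt_eq_0_iff: "elt p q r = 0 \<longleftrightarrow> p = 0 \<and> q = 0 \<and> r = 0"
proof
  assume *: "elt p q r = 0"
  show "p = 0 \<and> q = 0 \<and> r = 0"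
  proof (rule ccontr)
    assume "\<not> ?thesis"
    then have "[:p, q, r:] \<noteq> 0" by auto
    moreover have "degree [:p, q, r:] < 3" by (auto intro: le_less_trans[OF degree_pCons_le] simp: degree_pCons_eq_if)
    ultimately obtain h where "ev h * ev [:p, q, r:] = 1" using small_inverse by blast
    then show False unfolding ev_small * by simp
  qed
qed (simp add: elt_def)

lemma elt_diff: "elt p q r - elt p' q' r' = elt (p - p') (q - q') (r - r')"
  by (simp add: elt_def of_rat_diff algebra_simps)

lemma elt_add: "elt p q r + elt p' q' r' = elt (p + p') (q + q') (r + r')"
  by (simp add: elt_def of_rat_add algebra_simps)

lemma elt_eq_iff: "elt p q r = elt p' q' r' \<longleftrightarrow> p = p' \<and> q = q' \<and> r = r'"
  using elt_eq_0_iff[of "p - p'" "q - q'" "r - r'"] elt_diff[of p q r p' q' r'] by auto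

lemma theta_cubed: "\<theta> ^ 3 = of_int a * \<theta> - of_int b"
  using root by (simp add: algebra_simps add_eq_0_iff2)

lemma elt_mult: "elt p q r * elt p' q' r' =
   elt (p * p' - of_int b * (q * r' + r * q'))
     (p * q' + q * p' + of_int a * (q * r' + r * q') - of_int b * (r * r'))
     (p * r' + q * q' + r * p' + of_int a * (r * r'))"
proof -
  have "elt p q r * elt p' q' r' = of_rat (p * p') + of_rat (p * q' + q * p') * \<theta>
     + of_rat (p * r' + q * q' + r * p') * \<theta>\<^sup>2 + of_rat (q * r' + r * q') * \<theta> ^ 3
     + of_rat (r * r') * (\<theta> ^ 3 * \<theta>)"
    by (simp add: elt_def of_rat_add of_rat_mult algebra_simps power2_eq_square power3_eq_cube)
  then show ?thesis unfolding theta_cubed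
    by (simp add: elt_def of_rat_add of_rat_diff of_rat_mult algebra_simps power2_eq_square)
qed

lemma is_subfield_elts: "is_subfield {elt p q r |p q r. True}" (is "is_subfield ?E")
proof -
  have "inverse (elt p q r) \<in> ?E" for p q r
  proof (cases "elt p q r = 0")
    case True
    then have "inverse (elt p q r) = elt 0 0 0" by (simp add: elt_def)
    then show ?thesis by blast
  next
    case False
    then have "[:p, q, r:] \<noteq> 0" by (auto simp: elt_eq_0_iff)
    moreover have "degree [:p, q, r:] < 3" by (auto simp: degree_pCons_eq_if)
    ultimately obtain h where "ev h * ev [:p, q, r:] = 1" using small_inverse by blast
    then have "inverse (elt p q r) = ev h" using False unfolding ev_small by (simp add: field_simps)
    then show ?thesis using ev_eq_elt[of h] by auto
  qed
  moreover have "0 = elt 0 0 0" "1 = elt 1 0 0" by (simp_all add: elt_def)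
  ultimately show ?thesis
    unfolding is_subfield_def using elt_diff elt_mult by blast
qed

lemma K_eq: "K = {elt p q r |p q r. True}"
proof
  have "\<theta> = elt 0 1 0" by (simp add: elt_def)
  then show "K \<subseteq> {elt p q r |p q r. True}"
    unfolding K using rat_adjoin_minimal[OF is_subfield_elts] by blast
next
  have sub: "is_subfield K" and th: "\<theta> \<in> K"
    by (simp_all add: K is_subfield_rat_adjoin in_rat_adjoin_self)
  show "{elt p q r |p q r. True} \<subseteq> K"
    by (auto simp: elt_def power2_eq_square intro!: is_subfieldD[OF sub] is_subfield_of_rat[OF sub] th)
qed

lemma elt_in_K [simp]: "elt p q r \<in> K"
  using K_eq by blast

lemma subfield_K: "is_subfield K"
  by (simp add: K is_subfield_rat_adjoin)

lemma rat_adjoin_eq_K: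
  assumes "\<eta> \<in> K" "\<theta> \<in> rat_adjoin \<eta>"
  shows "K = rat_adjoin \<eta>"
  using rat_adjoin_minimal[OF subfield_K assms(1)]
    rat_adjoin_minimal[OF is_subfield_rat_adjoin assms(2)] K by auto

text \<open>A rational root would split off a linear factor with a quadratic cofactor, and neither
  is a unit.\<close>

lemma no_rational_root: "x ^ 3 - of_int a * x + of_int b \<noteq> (0::rat)"
proof
  assume *: "x ^ 3 - of_int a * x + of_int b = 0"
  have "poly min_cubic x = 0" using * by (simp add: min_cubic_def algebra_simps power3_eq_cube)
  then have "[:-x, 1:] dvd min_cubic" by (simp add: poly_eq_0_iff_dvd)
  then obtain h where h: "min_cubic = [:-x, 1:] * h" by blast
  have "min_cubic \<noteq> 0" by (simp add: min_cubic_def)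
  then have "h \<noteq> 0" using h by auto
  then have "degree min_cubic = 1 + degree h" unfolding h by (subst degree_mult_eq) auto
  then have "degree h = 2" by (simp add: min_cubic_def)
  moreover have "is_unit [:-x, 1:] \<or> is_unit h" using irr h unfolding min_cubic_def by (rule irreducibleD)
  ultimately show False by (auto simp: is_unit_iff_degree \<open>h \<noteq> 0\<close>)
qed

text \<open>For \<open>\<eta> = elt p q r\<close> this is the determinant of
  \<open>1, \<eta>, \<eta>\<^sup>2\<close> in the basis
  \<open>1, \<theta>, \<theta>\<^sup>2\<close>; it does not depend on \<open>p\<close>.\<close>

definition index_form :: "rat \<Rightarrow> rat \<Rightarrow> rat" where
  "index_form q r = q ^ 3 - of_int a * q * r\<^sup>2 + of_int b * r ^ 3"

text \<open>For \<open>r \<noteq> 0\<close> the form is \<open>r ^ 3\<close> times the defining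
  cubic at \<open>q / r\<close>, and that cubic has no rational root.\<close>

lemma index_form_nonzero:
  assumes "q \<noteq> 0 \<or> r \<noteq> 0"
  shows "index_form q r \<noteq> 0"
proof (cases "r = 0")
  case True
  then show ?thesis using assms by (simp add: index_form_def)
next
  case False
  then have "index_form q r = r ^ 3 * ((q / r) ^ 3 - of_int a * (q / r) + of_int b)"
    by (simp add: index_form_def field_simps power2_eq_square power3_eq_cube)
  then show ?thesis using False no_rational_root[of "q / r"] by simp
qed

text \<open>Eliminating \<open>c1\<close> between the \<theta> and \<open>\<theta>\<^sup>2\<close>
  coordinates of a quadratic relation for \<eta> leaves \<open>c2 * index_form q r = 0\<close>;
  hence an element outside the rationals has degree 3.\<close>

lemma small_poly_at_elt:
  assumes "q \<noteq> 0 \<or> r \<noteq> 0" "elt p q r = \<eta>" "degree g < 3" "poly (map_poly of_rat g) \<eta> = 0"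
  shows "g = 0"
proof -
  obtain c0 c1 c2 where g: "g = [:c0, c1, c2:]" using quadratic_poly_eq[OF assms(3)] by metis
  have of: "of_rat c = elt c 0 0" for c by (simp add: elt_def)
  have "of_rat c0 + of_rat c1 * \<eta> + of_rat c2 * (\<eta> * \<eta>) = 0"
    using assms(4) unfolding g by (simp add: algebra_simps hom_distribs)
  then have eqs: "c1 * q + c2 * (2 * p * q + 2 * of_int a * q * r - of_int b * r\<^sup>2) = 0"
    "c1 * r + c2 * (2 * p * r + q\<^sup>2 + of_int a * r\<^sup>2) = 0" "c0 + c1 * p + c2 * (p * p - of_int b * (2 * q * r)) = 0"
    unfolding assms(2)[symmetric] of elt_mult elt_add elt_eq_0_iff
    by (simp_all add: algebra_simps power2_eq_square)
  have "c2 * index_form q r = 0"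
    (is "?l = 0")
  proof -
    have "?l = q * (c1 * r + c2 * (2 * p * r + q\<^sup>2 + of_int a * r\<^sup>2))
        - r * (c1 * q + c2 * (2 * p * q + 2 * of_int a * q * r - of_int b * r\<^sup>2))"
      by (simp add: index_form_def algebra_simps power2_eq_square power3_eq_cube)
    then show ?thesis unfolding eqs by simp
  qed
  then have "c2 = 0" using index_form_nonzero[OF assms(1)] by simp
  then show ?thesis using eqs assms(1) g by auto
qed

end

section \<open>Characteristic polynomials of multiplication maps\<close>

lemma mult_mat_root_char_poly:
  fixes \<eta> :: "'a::field_char_0"
  assumes M: "is_mult_mat bs \<eta> M" and nz: "\<exists>x\<in>set bs. x \<noteq> 0"
  shows "poly (map_poly of_rat (char_poly M)) \<eta> = 0"
proof -
  define n where "n = length bs"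
  have Mc: "M \<in> carrier_mat n n"
    and cols: "\<And>j. j < n \<Longrightarrow> \<eta> * bs ! j = (\<Sum>i<n. of_rat (M $$ (i, j)) * bs ! i)"
    using M by (auto simp: is_mult_mat_def n_def rat_scale_def)
  define A where "A = map_mat (of_rat :: rat \<Rightarrow> 'a) (transpose_mat M)"
  have A: "A \<in> carrier_mat n n" using Mc by (simp add: A_def)
  let ?v = "vec n (\<lambda>i. bs ! i)"
  \<comment> \<open>The columns of \<open>M\<close> become the rows of \<open>A\<close>, so the list
    of basis elements is itself an eigenvector of \<open>A\<close> with eigenvalue \<eta>.
    Transposition does not change the characteristic polynomial.\<close>
  have "A *\<^sub>v ?v = \<eta> \<cdot>\<^sub>v ?v"
  proof (rule eq_vecI)
    fix j assume "j < dim_vec (\<eta> \<cdot>\<^sub>v ?v)"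
    then have j: "j < n" by simp
    then have "(A *\<^sub>v ?v) $ j = (\<Sum>i<n. of_rat (M $$ (i, j)) * bs ! i)"
      using Mc by (simp add: A_def scalar_prod_def atLeast0LessThan)
    then show "(A *\<^sub>v ?v) $ j = (\<eta> \<cdot>\<^sub>v ?v) $ j" using cols[OF j] j by simp
  qed (use A in simp)
  moreover have "?v \<noteq> 0\<^sub>v n"
  proof
    assume 0: "?v = 0\<^sub>v n"
    obtain i where "i < n" "bs ! i \<noteq> 0" using nz by (auto simp: in_set_conv_nth n_def)
    then show False using arg_cong[OF 0, of "\<lambda>v. v $ i"] by simp
  qed
  ultimately have "eigenvalue A \<eta>"
    using A unfolding eigenvalue_def eigenvector_def by (intro exI[of _ ?v]) auto
  then have "poly (char_poly A) \<eta> = 0" using eigenvalue_root_char_poly[OF A] by simp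
  also have "char_poly A = map_poly of_rat (char_poly M)"
    using Mc by (simp add: A_def of_rat_hom.char_poly_hom[of _ n] transpose_carrier_mat)
  finally show ?thesis .
qed

context cubic_field
begin

lemma is_rat_basis_powers: "is_rat_basis K [1, \<theta>, \<theta>\<^sup>2]"
proof -
  have ne: "1 \<noteq> \<theta>" "1 \<noteq> \<theta>\<^sup>2" "\<theta> \<noteq> \<theta>\<^sup>2"
    using elt_eq_iff[of 1 0 0 0 1 0] elt_eq_iff[of 1 0 0 0 0 1] elt_eq_iff[of 0 1 0 0 0 1]
    by (auto simp: elt_def)
  have "rat_vs.independent {1, \<theta>, \<theta>\<^sup>2}"
  proof
    assume "rat_vs.dependent {1, \<theta>, \<theta>\<^sup>2}"
    then obtain u where u: "\<exists>v\<in>{1, \<theta>, \<theta>\<^sup>2}. u v \<noteq> 0" "(\<Sum>v\<in>{1, \<theta>, \<theta>\<^sup>2}. rat_scale (u v) v) = 0"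
      by (subst (asm) rat_vs.dependent_finite) auto
    have "elt (u 1) (u \<theta>) (u (\<theta>\<^sup>2)) = 0"
      using u(2) ne by (simp add: elt_def rat_scale_def add.assoc)
    then show False using u(1) by (auto simp: elt_eq_0_iff)
  qed
  moreover have "rat_vs.span {1, \<theta>, \<theta>\<^sup>2} = K"
    unfolding K_eq rat_vs.span_insert rat_vs.span_empty
    by (auto simp: elt_def rat_scale_def algebra_simps)
  ultimately show ?thesis using ne by (simp add: is_rat_basis_def)
qed

lemma length_rat_basis: "is_rat_basis K bs \<Longrightarrow> length bs = 3"
proof -
  assume bs: "is_rat_basis K bs"
  have "length bs' = rat_vs.dim K" if "is_rat_basis K bs'" for bs'
    using that rat_vs.dim_eq_card_independent[of "set bs'"] rat_vs.dim_span[of "set bs'"]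
    by (auto simp: is_rat_basis_def distinct_card)
  from this[OF bs] this[OF is_rat_basis_powers] show ?thesis by simp
qed

lemma is_mult_mat_exists:
  assumes "\<eta> \<in> K"
  shows "\<exists>M. is_mult_mat [1, \<theta>, \<theta>\<^sup>2] \<eta> M"
proof -
  have "\<forall>x\<in>K. \<exists>c::nat \<Rightarrow> rat. x = elt (c 0) (c 1) (c 2)"
  proof
    fix x assume "x \<in> K"
    then obtain p q r where "x = elt p q r" by (auto simp: K_eq)
    then show "\<exists>c::nat \<Rightarrow> rat. x = elt (c 0) (c 1) (c 2)"
      by (intro exI[of _ "\<lambda>n. if n = 0 then p else if n = 1 then q else r"]) simp
  qed
  then obtain c :: "'a \<Rightarrow> nat \<Rightarrow> rat" where c: "\<And>x. x \<in> K \<Longrightarrow> x = elt (c x 0) (c x 1) (c x 2)"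
    by metis
  let ?bs = "[1, \<theta>, \<theta>\<^sup>2]"
  have *: "\<eta> * ?bs ! j \<in> K" if "j < 3" for j
  proof -
    from that have "j = 0 \<or> j = 1 \<or> j = 2" by linarith
    then have "?bs ! j \<in> {elt 1 0 0, elt 0 1 0, elt 0 0 1}" by (auto simp: elt_def)
    then show ?thesis by (auto intro!: is_subfieldD[OF subfield_K] assms)
  qed
  have "is_mult_mat ?bs \<eta> (mat 3 3 (\<lambda>(i, j). c (\<eta> * ?bs ! j) i))"
    unfolding is_mult_mat_def
  proof (intro conjI allI impI)
    fix j assume "j < length ?bs"
    then have j: "j < 3" by simp
    show "\<eta> * ?bs ! j = (\<Sum>i<length ?bs. rat_scale (mat 3 3 (\<lambda>(i, j). c (\<eta> * ?bs ! j) i) $$ (i, j)) (?bs ! i))"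
      using c[OF *[OF j]] j by (simp add: eval_nat_numeral elt_def rat_scale_def)
  qed (simp add: numeral_3_eq_3)
  then show ?thesis by blast
qed

text \<open>The leading terms cancel in \<open>g - h\<close>, which then has degree less than 3 and
  vanishes at \<eta>.\<close>

lemma monic_cubic_unique:
  assumes "q \<noteq> 0 \<or> r \<noteq> 0" "\<eta> = elt p q r"
    "degree g = 3" "lead_coeff g = 1" "poly (map_poly of_rat g) \<eta> = 0"
    "degree h = 3" "lead_coeff h = 1" "poly (map_poly of_rat h) \<eta> = 0"
  shows "g = h"
proof -
  interpret h: map_poly_comm_ring_hom "of_rat :: rat \<Rightarrow> 'a" ..
  have "degree (g - h) \<le> 3" by (rule degree_diff_le) (use assms in auto)
  moreover have "coeff (g - h) 3 = 0" using assms by simp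
  then have "degree (g - h) \<noteq> 3 \<or> g - h = 0" by (metis leading_coeff_0_iff)
  ultimately have "degree (g - h) < 3" by auto
  moreover have "poly (map_poly of_rat (g - h)) \<eta> = 0" using assms by (simp add: hom_distribs)
  ultimately have "g - h = 0" using small_poly_at_elt[OF assms(1) assms(2)[symmetric]] by blast
  then show ?thesis by simp
qed

text \<open>Every basis has three elements, so every admissible \<open>char_poly M\<close> is a
  monic cubic with root \<eta> and must be \<open>F\<close>. The basis of powers of \<theta>
  supplies existence, so no matrix has to be computed.\<close>

lemma field_char_poly_eqI:
  fixes F :: "int poly"
  assumes \<eta>: "q \<noteq> 0 \<or> r \<noteq> 0" "\<eta> = elt p q r"
    and F: "degree F = 3" "lead_coeff F = 1" "poly (map_poly of_int F) \<eta> = 0"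
  shows "field_char_poly K \<eta> = F"
proof -
  have FQ: "map_poly of_rat (map_poly of_int F :: rat poly) = (map_poly of_int F :: 'a poly)"
    by (simp add: map_poly_map_poly o_def)
  have char: "char_poly M = map_poly of_int F" if bs: "is_rat_basis K bs" and M: "is_mult_mat bs \<eta> M" for bs M
  proof (rule monic_cubic_unique[OF \<eta>])
    have "M \<in> carrier_mat 3 3" using length_rat_basis[OF bs] M by (simp add: is_mult_mat_def)
    from degree_monic_char_poly[OF this] show "degree (char_poly M) = 3" "lead_coeff (char_poly M) = 1"
      by auto
    have "\<exists>x\<in>set bs. x \<noteq> 0"
    proof (rule ccontr)
      assume "\<not> (\<exists>x\<in>set bs. x \<noteq> 0)"
      then have "set bs \<subseteq> {0}" by auto
      from card_mono[OF _ this] show False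
        using length_rat_basis[OF bs] bs by (simp add: is_rat_basis_def distinct_card)
    qed
    then show "poly (map_poly of_rat (char_poly M)) \<eta> = 0" by (rule mult_mat_root_char_poly[OF M])
    show "poly (map_poly of_rat (map_poly of_int F)) \<eta> = 0" unfolding FQ by (rule F)
  qed (use F in auto)
  obtain M where M: "is_mult_mat [1, \<theta>, \<theta>\<^sup>2] \<eta> M" using is_mult_mat_exists[OF elt_in_K[of p q r]] \<eta>(2) by auto
  show ?thesis unfolding field_char_poly_def
  proof (rule the_equality)
    show "\<exists>bs M. is_rat_basis K bs \<and> is_mult_mat bs \<eta> M \<and> map_poly of_int F = char_poly M"
      using is_rat_basis_powers M char[OF is_rat_basis_powers M] by metis
  next
    fix F' :: "int poly"
    assume "\<exists>bs M. is_rat_basis K bs \<and> is_mult_mat bs \<eta> M \<and> map_poly of_int F' = char_poly M"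
    then have "map_poly of_int F' = (map_poly of_int F :: rat poly)" using char by metis
    then show "F' = F" using of_int_poly_hom.injectivity by blast
  qed
qed

lemma elt_rational_iff: "elt p q r \<in> \<rat> \<longleftrightarrow> q = 0 \<and> r = 0"
proof
  assume "elt p q r \<in> \<rat>"
  then obtain x where "elt p q r = of_rat x" by (auto elim: Rats_cases)
  then have "elt p q r = elt x 0 0" by (simp add: elt_def)
  then show "q = 0 \<and> r = 0" by (simp add: elt_eq_iff)
qed (simp add: elt_def)

text \<open>A rational \<eta> would generate only the rationals, which do not contain
  \<theta>.\<close>

lemma primitive_elt:
  assumes "\<eta> \<in> primitive_integers K"
  obtains p q r where "\<eta> = elt p q r" "q \<noteq> 0 \<or> r \<noteq> 0"
proof -
  have \<eta>: "\<eta> \<in> K" "K = rat_adjoin \<eta>" using assms by (auto simp: primitive_integers_def ring_of_integers_def)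
  then obtain p q r where e: "\<eta> = elt p q r" by (auto simp: K_eq)
  have "\<not> (q = 0 \<and> r = 0)"
  proof
    assume "q = 0 \<and> r = 0"
    then have "\<eta> \<in> \<rat>" unfolding e by (simp add: elt_rational_iff)
    then have "K \<subseteq> \<rat>" using rat_adjoin_minimal[OF is_subfield_Rats] \<eta> by auto
    then have "elt 0 1 0 \<in> \<rat>" by auto
    then show False by (simp add: elt_rational_iff)
  qed
  then show ?thesis using that e by blast
qed

lemma primitive_integerI:
  assumes "\<eta> \<in> K" "\<theta> \<in> rat_adjoin \<eta>" "\<eta> ^ 3 + of_int c2 * \<eta>\<^sup>2 + of_int c1 * \<eta> + of_int c0 = 0"
  shows "\<eta> \<in> primitive_integers K" "field_char_poly K \<eta> = [:c0, c1, c2, 1:]"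
proof -
  have F: "degree [:c0, c1, c2, 1:] = 3" "lead_coeff [:c0, c1, c2, 1:] = 1"
    "poly (map_poly of_int [:c0, c1, c2, 1:]) \<eta> = 0"
    using assms(3) by (simp_all add: algebra_simps power2_eq_square power3_eq_cube hom_distribs)
  then have "algebraic_int \<eta>" unfolding algebraic_int_altdef_ipoly by blast
  then show prim: "\<eta> \<in> primitive_integers K"
    using assms(1) rat_adjoin_eq_K[OF assms(1,2)] by (simp add: primitive_integers_def ring_of_integers_def)
  obtain p q r where "\<eta> = elt p q r" "q \<noteq> 0 \<or> r \<noteq> 0" using primitive_elt[OF prim] by blast
  then show "field_char_poly K \<eta> = [:c0, c1, c2, 1:]" using F by (intro field_char_poly_eqI) auto
qed

end

section \<open>Integrality and p-adic lifting\<close>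

lemma clear_denominators:
  fixes g :: "rat poly"
  obtains d :: int and h :: "int poly" where "d > 0" "map_poly of_int h = Polynomial.smult (of_int d) g"
proof -
  have "\<exists>d>0. \<exists>h::int poly. map_poly of_int h = Polynomial.smult (of_int d) g"
  proof (induction g)
    case 0
    then show ?case by (intro exI[of _ 1] conjI exI[of _ 0]) auto
  next
    case (pCons c g)
    obtain d h where dh: "d > 0" "map_poly of_int h = Polynomial.smult (of_int d) g" using pCons by blast
    obtain m n where mn: "c = of_int m / of_int n" "n > 0"
      by (metis quotient_of_denom_pos quotient_of_div surj_pair)
    have "map_poly of_int (pCons (d * m) (Polynomial.smult n h)) = Polynomial.smult (of_int (d * n)) (pCons c g)"
      using mn dh(2) by (simp add: hom_distribs mult.commute)
    then show ?case using dh(1) mn(2) by (meson mult_pos_pos)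
  qed
  then show ?thesis using that by blast
qed

text \<open>Gauss's lemma: after clearing denominators the factors have leading coefficients
  \<open>d\<close> and \<open>e\<close>, and their contents multiply to \<open>d * e\<close>. Each
  content divides its leading coefficient, so \<open>A\<close> has content \<open>d\<close>, which
  can be divided out.\<close>

lemma monic_rat_divisor_is_int:
  fixes G :: "int poly" and g :: "rat poly"
  assumes "lead_coeff G = 1" "lead_coeff g = 1" "g dvd map_poly of_int G"
  obtains h :: "int poly" where "g = map_poly of_int h"
proof -
  obtain g' where g': "map_poly of_int G = g * g'" using assms(3) by blast
  have "lead_coeff (map_poly of_int G :: rat poly) = 1" using assms(1) by simp
  then have lead_g': "lead_coeff g' = 1" unfolding g' lead_coeff_mult assms(2) by simp
  obtain d A where A: "d > 0" "map_poly of_int A = Polynomial.smult (of_int d) g" using clear_denominators .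
  obtain e B where B: "e > 0" "map_poly of_int B = Polynomial.smult (of_int e) g'" using clear_denominators .
  have "of_int (lead_coeff A) = (of_int d :: rat)" "of_int (lead_coeff B) = (of_int e :: rat)"
    using arg_cong[OF A(2), of lead_coeff] arg_cong[OF B(2), of lead_coeff] assms(2) lead_g' by auto
  then have lead: "lead_coeff A = d" "lead_coeff B = e" by simp_all
  have "map_poly of_int (A * B) = (map_poly of_int (Polynomial.smult (d * e) G) :: rat poly)"
    using A B g' by (simp add: hom_distribs mult.commute)
  then have "A * B = Polynomial.smult (d * e) G" using of_int_poly_hom.injectivity by blast
  then have "content A * content B = content (Polynomial.smult (d * e) G)" by (metis content_mult)
  also have "content G dvd 1" using content_dvd_coeff[of G "degree G"] assms(1) by simp
  then have "content G = 1" by (simp only: is_unit_content_iff)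
  then have "content (Polynomial.smult (d * e) G) = d * e" using A B by (simp add: abs_mult)
  finally have AB: "content A * content B = d * e" .
  have "content A dvd d" "content B dvd e" using lead content_dvd_coeff by metis+
  moreover have "content A \<ge> 0" "content B \<ge> 0"
    by (metis abs_ge_zero normalize_content normalize_int_def)+
  ultimately have le: "0 \<le> content A" "content A \<le> d" "0 \<le> content B" "content B \<le> e"
    using A B by (auto dest: zdvd_imp_le)
  have "content A = d"
  proof (rule ccontr)
    assume "content A \<noteq> d"
    then have "content A < d" using le by simp
    then have "content A * content B < d * e"
      using le A B by (smt (verit) mult_mono mult_strict_right_mono mult_left_mono)
    then show False using AB by simp
  qed
  then have "[:d:] dvd A" using const_poly_dvd_iff_dvd_content[of d A] by simp
  then obtain h where h: "A = Polynomial.smult d h" by (metis dvdE mult_pCons_left mult_zero_left add.right_neutral pCons_0_0)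
  have "Polynomial.smult (of_int d) (map_poly of_int h) = Polynomial.smult (of_int d) g"
    using A(2) unfolding h by (simp add: hom_distribs)
  then show ?thesis using that[of h] A(1) by (metis less_irrefl of_int_eq_0_iff smult_eq_iff)
qed

section \<open>Hensel lifting and approximate p-adic roots\<close>

lemma hensel_cubic:
  fixes p n c0 c1 c2 :: int
  assumes "prime p" "p dvd poly [:c0, c1, c2, 1:] n" "\<not> p dvd 3 * n\<^sup>2 + 2 * c2 * n + c1"
  shows "\<exists>m. p ^ k dvd poly [:c0, c1, c2, 1:] m \<and> [m = n] (mod p)"
proof -
  let ?F = "poly [:c0, c1, c2, 1:]"
  \<comment> \<open>With exponent \<open>Suc k\<close> the hypothesis on \<open>n\<close> is the
    base case; one power is given up at the end.\<close>
  have "\<exists>m. p ^ Suc k dvd ?F m \<and> [m = n] (mod p)"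
  proof (induction k)
    case 0
    then show ?case using assms by auto
  next
    case (Suc k)
    then obtain m s where m: "?F m = p ^ Suc k * s" "[m = n] (mod p)" by (auto elim!: dvdE)
    define D where "D = 3 * m\<^sup>2 + 2 * c2 * m + c1"
    have "[D = 3 * n\<^sup>2 + 2 * c2 * n + c1] (mod p)"
      unfolding D_def by (intro cong_add cong_mult cong_pow cong_refl m)
    then have "\<not> p dvd D" using assms(3) cong_dvd_iff by blast
    then have "coprime D p" using assms(1) prime_imp_coprime coprime_commute by blast
    \<comment> \<open>Newton's correction: \<open>t\<close> makes the linear term of the expansion
      of \<open>?F\<close> at \<open>m\<close> cancel \<open>s\<close> modulo \<open>p\<close>,
      while the remaining terms carry \<open>p ^ Suc k\<close> twice.\<close>
    then obtain t where t: "[D * t = - s] (mod p)" using cong_solve_coprime_int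
      by (metis (no_types, opaque_lifting) cong_scalar_right mult.assoc mult.left_neutral)
    then have pd: "p dvd s + D * t" by (simp add: cong_iff_dvd_diff add.commute)
    have "?F (m + p ^ Suc k * t) = ?F m + p ^ Suc k * t * D + p ^ Suc k * p ^ Suc k * (t\<^sup>2 * (3 * m + p ^ Suc k * t + c2))"
      by (simp add: D_def algebra_simps power2_eq_square)
    also have "\<dots> = p ^ Suc k * (s + D * t) + p ^ Suc k * p * (p ^ k * (t\<^sup>2 * (3 * m + p ^ Suc k * t + c2)))"
      unfolding m(1) by (simp add: algebra_simps)
    finally have "?F (m + p ^ Suc k * t) = \<dots>" .
    moreover obtain z where "s + D * t = p * z" using pd by blast
    ultimately have "?F (m + p ^ Suc k * t) = p ^ Suc (Suc k) * (z + p ^ k * (t\<^sup>2 * (3 * m + p ^ Suc k * t + c2)))"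
      by (simp add: algebra_simps)
    then have "p ^ Suc (Suc k) dvd ?F (m + p ^ Suc k * t)" by simp
    moreover have "[m + p ^ Suc k * t = n] (mod p)"
      using cong_add[OF m(2), of "p ^ Suc k * t" 0] by (simp add: cong_0_iff)
    ultimately show ?case by blast
  qed
  then show ?thesis by (meson dvd_trans le_imp_power_dvd le_SucI order_refl)
qed

text \<open>Read p-adically, \<open>U / W\<close> is a root of a monic cubic with integer
  coefficients, hence integral. \<open>U\<close> may change with \<open>k\<close>, but
  \<open>C\<close> and \<open>W\<close> are fixed, so the precision they cost is bounded.\<close>

lemma padic_root_clear_denominator:
  fixes p a b C W :: int
  assumes p: "prime p" and nz: "C \<noteq> 0" "W \<noteq> 0"
    and U: "\<And>k. \<exists>U. p ^ k dvd C * (U ^ 3 - a * U * W\<^sup>2 + b * W ^ 3)"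
  shows "\<exists>y. p ^ k dvd y ^ 3 - a * y + b"
proof -
  have p1: "\<not> is_unit p" "p \<noteq> 0" using p by auto
  have decomp: "\<exists>i x. X = p ^ i * x \<and> \<not> p dvd x" if "X \<noteq> 0" for X
    using multiplicity_decompose'[of X p] that p1 by metis
  obtain w j where w: "W = p ^ j * w" "\<not> p dvd w" using decomp[OF nz(2)] by blast
  obtain c e where c: "C = p ^ e * c" "\<not> p dvd c" using decomp[OF nz(1)] by blast
  \<comment> \<open>The exponent allows for the factor \<open>p ^ e\<close> of \<open>C\<close> and
    the factor \<open>p ^ (3 * j)\<close> of \<open>W ^ 3\<close>.\<close>
  obtain U where U': "p ^ (e + (3 * j + Suc k)) dvd C * (U ^ 3 - a * U * W\<^sup>2 + b * W ^ 3)"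
    using U by blast
  have "p ^ (3 * j + Suc k) dvd c * (U ^ 3 - a * U * W\<^sup>2 + b * W ^ 3)"
    using U' p1 unfolding c(1) power_add[of p e] mult.assoc dvd_mult_cancel_left by simp
  moreover have "coprime (p ^ (3 * j + Suc k)) c"
    using c(2) p prime_imp_coprime by (intro coprime_power_left_iff[THEN iffD2]) auto
  ultimately have dvd: "p ^ (3 * j + Suc k) dvd U ^ 3 - a * U * W\<^sup>2 + b * W ^ 3"
    by (simp add: coprime_dvd_mult_right_iff)
  \<comment> \<open>If \<open>U\<close> had smaller valuation than \<open>W\<close>, then
    \<open>U ^ 3\<close> would be the only term of lowest valuation and could not be
    cancelled.\<close>
  have "p ^ j dvd U"
  proof (rule ccontr)
    assume nd: "\<not> p ^ j dvd U"
    then have U0: "U \<noteq> 0" by auto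
    obtain u i where u: "U = p ^ i * u" "\<not> p dvd u" using decomp[OF U0] by blast
    have "i < j" using nd u(1) by (metis dvd_triv_left le_imp_power_dvd dvd_trans not_le)
    then obtain l where l: "j = i + Suc l" using less_iff_Suc_add by auto
    have "U ^ 3 - a * U * W\<^sup>2 + b * W ^ 3 = p ^ (3 * i) * (u ^ 3 + p * (p ^ l * (b * p ^ Suc l * p ^ Suc l * w ^ 3 - a * u * p ^ Suc l * w\<^sup>2)))"
      unfolding u(1) w(1) l
      by (simp add: algebra_simps power_add power2_eq_square power3_eq_cube power_mult)
    moreover have "p ^ (3 * i) * p dvd p ^ (3 * j + Suc k)"
      unfolding l power_Suc2[symmetric] by (rule le_imp_power_dvd) simp
    ultimately have "p ^ (3 * i) * p dvd p ^ (3 * i) * (u ^ 3 + p * (p ^ l * (b * p ^ Suc l * p ^ Suc l * w ^ 3 - a * u * p ^ Suc l * w\<^sup>2)))"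
      using dvd dvd_trans by (metis (no_types))
    then have "p dvd u ^ 3 + p * (p ^ l * (b * p ^ Suc l * p ^ Suc l * w ^ 3 - a * u * p ^ Suc l * w\<^sup>2))"
      using p1 by simp
    then have "p dvd u ^ 3" by (simp add: dvd_add_left_iff)
    then show False using u(2) p prime_dvd_power by blast
  qed
  then obtain u where u: "U = p ^ j * u" by blast
  have "U ^ 3 - a * U * W\<^sup>2 + b * W ^ 3 = p ^ (3 * j) * (u ^ 3 - a * u * w\<^sup>2 + b * w ^ 3)"
    unfolding u w(1)
    by (simp add: algebra_simps power2_eq_square power3_eq_cube power_mult)
  then have "p ^ Suc k dvd u ^ 3 - a * u * w\<^sup>2 + b * w ^ 3"
    using dvd p1 by (simp add: power_add)
  then have dk: "p ^ k dvd u ^ 3 - a * u * w\<^sup>2 + b * w ^ 3"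
    by (meson dvd_trans le_imp_power_dvd le_SucI order_refl)
  \<comment> \<open>Now \<open>w\<close> is invertible modulo \<open>p ^ k\<close>; with inverse
    \<open>v\<close>, the approximate root is \<open>u * v\<close>.\<close>
  have "coprime w (p ^ k)" using w(2) p prime_imp_coprime coprime_commute by (metis coprime_power_right_iff)
  then obtain v where v: "[w * v = 1] (mod p ^ k)" using cong_solve_coprime_int by blast
  have e1: "[v ^ 3 * (u ^ 3 - a * u * w\<^sup>2 + b * w ^ 3) = v ^ 3 * 0] (mod p ^ k)"
    by (intro cong_mult cong_refl) (simp add: dk cong_0_iff)
  have e2: "v ^ 3 * (u ^ 3 - a * u * w\<^sup>2 + b * w ^ 3) = (u * v) ^ 3 - a * (u * v) * (w * v)\<^sup>2 + b * (w * v) ^ 3"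
    by (simp add: algebra_simps power2_eq_square power3_eq_cube)
  have e3: "[(u * v) ^ 3 - a * (u * v) * (w * v)\<^sup>2 + b * (w * v) ^ 3 = (u * v) ^ 3 - a * (u * v) * 1\<^sup>2 + b * 1 ^ 3] (mod p ^ k)"
    by (intro cong_add cong_diff cong_mult cong_pow cong_refl v)
  have "[(u * v) ^ 3 - a * (u * v) + b = 0] (mod p ^ k)"
    using cong_trans[OF cong_sym[OF e3] e1[unfolded e2]]
    by (simp only: mult_zero_right power_one mult_1_right)
  then show ?thesis unfolding cong_0_iff by blast
qed

section \<open>Characteristic polynomials in a cubic field\<close>

context cubic_field
begin

text \<open>\<open>tr1\<close>, \<open>tr2\<close>, \<open>tr3\<close> are the lower coefficients,
  in degrees 2, 1 and 0, of the characteristic polynomial of \<open>elt 0 q r\<close>.\<close>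

definition tr1 :: "rat \<Rightarrow> rat \<Rightarrow> rat" where
  "tr1 q r = - 2 * of_int a * r"

definition tr2 :: "rat \<Rightarrow> rat \<Rightarrow> rat" where
  "tr2 q r = of_int a ^ 2 * r\<^sup>2 - of_int a * q\<^sup>2 + 3 * of_int b * q * r"

definition tr3 :: "rat \<Rightarrow> rat \<Rightarrow> rat" where
  "tr3 q r = of_int b * (q ^ 3 - of_int a * q * r\<^sup>2 - of_int b * r ^ 3)"

text \<open>The characteristic polynomial of \<open>elt p q r\<close>, obtained from the case
  \<open>p = 0\<close> by a translation and expanded so that coefficients can be compared.\<close>

definition char_cubic :: "rat \<Rightarrow> rat \<Rightarrow> rat \<Rightarrow> rat poly" where
  "char_cubic p q r = [:- (p ^ 3) + tr1 q r * p\<^sup>2 - tr2 q r * p + tr3 q r, 3 * p\<^sup>2 - 2 * tr1 q r * p + tr2 q r, tr1 q r - 3 * p, 1:]"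

lemma poly_char_cubic:
  "poly (char_cubic p q r) x = (x - p) ^ 3 + tr1 q r * (x - p)\<^sup>2 + tr2 q r * (x - p) + tr3 q r"
  by (simp add: char_cubic_def algebra_simps power2_eq_square power3_eq_cube)

lemma char_cubic_root: "poly (map_poly of_rat (char_cubic p q r)) (elt p q r) = 0"
proof -
  let ?x = "elt 0 q r"
  have shift: "elt p q r = of_rat p + ?x" by (simp add: elt_def)
  have scale: "of_rat c * elt p' q' r' = elt (c * p') (c * q') (c * r')" for c p' q' r'
    by (simp add: elt_def of_rat_mult algebra_simps)
  have of: "of_rat c = elt c 0 0" for c by (simp add: elt_def)
  have "poly (map_poly of_rat (char_cubic p q r)) (of_rat p + ?x)
      = ?x * ?x * ?x + of_rat (tr1 q r) * (?x * ?x) + of_rat (tr2 q r) * ?x + of_rat (tr3 q r)"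
    by (simp add: char_cubic_def hom_distribs of_rat_add of_rat_diff of_rat_mult of_rat_power of_rat_minus
        algebra_simps power2_eq_square power3_eq_cube)
  also have "\<dots> = 0"
    unfolding of[of "tr3 q r"] elt_mult scale elt_add elt_eq_0_iff unfolding tr1_def tr2_def tr3_def
    by (intro conjI) (simp_all add: algebra_simps power2_eq_square power3_eq_cube)
  finally show ?thesis unfolding shift .
qed

text \<open>The quotient of the two discriminants is the square of \<open>det (1, \<eta>, \<eta>\<^sup>2)\<close> in the basis
  \<open>1, \<theta>, \<theta>\<^sup>2\<close>.\<close>

lemma char_cubic_disc:
  fixes c0 c1 c2 :: rat
  assumes "char_cubic p q r = [:c0, c1, c2, 1:]"
  shows "c2\<^sup>2 * c1\<^sup>2 - 4 * c1 ^ 3 - 4 * c2 ^ 3 * c0 - 27 * c0\<^sup>2 + 18 * c2 * c1 * c0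
    = (index_form q r)\<^sup>2 * of_int (4 * a ^ 3 - 27 * b\<^sup>2)"
proof -
  define s1 s2 s3 where s: "s1 = tr1 q r" "s2 = tr2 q r" "s3 = tr3 q r"
  have c: "c0 = - (p ^ 3) + s1 * p\<^sup>2 - s2 * p + s3" "c1 = 3 * p\<^sup>2 - 2 * s1 * p + s2" "c2 = s1 - 3 * p"
    using assms by (simp_all add: char_cubic_def s)
  \<comment> \<open>The discriminant is invariant under translation, so \<open>p\<close> drops
    out.\<close>
  have "c2\<^sup>2 * c1\<^sup>2 - 4 * c1 ^ 3 - 4 * c2 ^ 3 * c0 - 27 * c0\<^sup>2 + 18 * c2 * c1 * c0
     = s1\<^sup>2 * s2\<^sup>2 - 4 * s2 ^ 3 - 4 * s1 ^ 3 * s3 - 27 * s3\<^sup>2 + 18 * s1 * s2 * s3"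
    unfolding c by (simp add: algebra_simps power2_eq_square power3_eq_cube)
  also have "\<dots> = (index_form q r)\<^sup>2 * of_int (4 * a ^ 3 - 27 * b\<^sup>2)"
    unfolding s tr1_def tr2_def tr3_def index_form_def of_int_diff of_int_mult of_int_power of_int_numeral
    by (simp add: algebra_simps eval_nat_numeral)
  finally show ?thesis .
qed

text \<open>With \<open>I = index_form q r\<close>, the polynomial in \<open>x\<close> below takes the value \<open>I * \<theta>\<close> at
  \<open>x = elt p q r\<close>; hence its image under the homogenized defining polynomial of \<open>\<theta>\<close> is a multiple
  of the characteristic polynomial.\<close>

lemma char_cubic_dvd:
  fixes q r :: rat
  defines "I \<equiv> index_form q r"
  shows "\<exists>g h. \<forall>x. poly g x ^ 3 - of_int a * poly g x * I\<^sup>2 + of_int b * I ^ 3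
     = poly (char_cubic p q r) x * poly h x"
proof -
  define A B where AB: "A = (of_int a :: rat)" "B = (of_int b :: rat)"
  \<comment> \<open>With \<open>\<xi> = elt 0 q r\<close>, the product of
    \<open>index_form q r\<close> and \<theta> is \<open>(q\<^sup>2 + A * r\<^sup>2) * \<xi> - r *
    \<xi>\<^sup>2 - 2 * B * q * r\<^sup>2\<close>, where \<open>A\<close> and \<open>B\<close> stand
    for the rational \<open>a\<close> and \<open>b\<close>. Composition with
    \<open>[:- p, 1:]\<close> accounts for \<open>p\<close>.\<close>
  define g where "g = [:- 2 * B * q * r\<^sup>2, q\<^sup>2 + A * r\<^sup>2, - r:] \<circ>\<^sub>p [:- p, 1:]"
  \<comment> \<open>The explicit quotient of the resulting sextic by the characteristic
    cubic.\<close>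
  define h where "h = [:q ^ 6 + 4 * q ^ 3 * r ^ 3 * B - q\<^sup>2 * r ^ 4 * A\<^sup>2 + 2 * q * r ^ 5 * A * B - r ^ 6 * B\<^sup>2,
     - 3 * q ^ 4 * r - q\<^sup>2 * r ^ 3 * A - 3 * q * r ^ 4 * B, 3 * q\<^sup>2 * r\<^sup>2 + r ^ 4 * A, - (r ^ 3):] \<circ>\<^sub>p [:- p, 1:]"
  have "poly g x ^ 3 - A * poly g x * I\<^sup>2 + B * I ^ 3 = poly (char_cubic p q r) x * poly h x" for x
  proof -
    define X where "X = x - p"
    have "poly [:- p, 1:] x = X" by (simp add: X_def)
    then have "poly g x = - 2 * B * q * r\<^sup>2 + X * (q\<^sup>2 + A * r\<^sup>2 - X * r)"
      "poly h x = q ^ 6 + 4 * q ^ 3 * r ^ 3 * B - q\<^sup>2 * r ^ 4 * A\<^sup>2 + 2 * q * r ^ 5 * A * B - r ^ 6 * B\<^sup>2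
       + X * (- 3 * q ^ 4 * r - q\<^sup>2 * r ^ 3 * A - 3 * q * r ^ 4 * B + X * (3 * q\<^sup>2 * r\<^sup>2 + r ^ 4 * A - X * r ^ 3))"
      by (simp_all add: g_def h_def poly_pcompose algebra_simps del: poly_pCons)
        (simp_all add: algebra_simps)
    note eqs = this
    show ?thesis
      unfolding eqs poly_char_cubic X_def[symmetric] I_def index_form_def tr1_def tr2_def tr3_def AB[symmetric]
      by (simp add: algebra_simps eval_nat_numeral)
  qed
  then show ?thesis unfolding AB by blast
qed

text \<open>A monic integer polynomial with root \<eta> leaves remainder 0 on division by
  \<open>char_cubic p q r\<close>, since \<eta> has degree 3. Gauss's lemma then makes the
  coefficients of the cubic integers.\<close>

lemma primitive_integer_char_poly:
  assumes "\<eta> \<in> primitive_integers K"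
  obtains p q r c0 c1 c2 where "q \<noteq> 0 \<or> r \<noteq> 0" "field_char_poly K \<eta> = [:c0, c1, c2, 1:]"
    "char_cubic p q r = map_poly of_int [:c0, c1, c2, 1:]"
proof -
  interpret h: map_poly_comm_ring_hom "of_rat :: rat \<Rightarrow> 'a" ..
  obtain p q r where \<eta>: "\<eta> = elt p q r" "q \<noteq> 0 \<or> r \<noteq> 0" using primitive_elt[OF assms] .
  let ?g = "char_cubic p q r"
  have g: "degree ?g = 3" "lead_coeff ?g = 1" "poly (map_poly of_rat ?g) \<eta> = 0" "?g \<noteq> 0"
    using char_cubic_root \<eta>(1) by (auto simp: char_cubic_def)
  have "algebraic_int \<eta>" using assms by (simp add: primitive_integers_def ring_of_integers_def)
  then obtain G :: "int poly" where G: "poly (map_poly of_int G) \<eta> = 0" "lead_coeff G = 1"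
    unfolding algebraic_int_altdef_ipoly by blast
  let ?G = "map_poly of_int G :: rat poly"
  have "map_poly of_rat ?G = (map_poly of_int G :: 'a poly)" by (simp add: map_poly_map_poly o_def)
  then have 0: "poly (map_poly of_rat (?G div ?g * ?g + ?G mod ?g)) \<eta> = 0"
    unfolding div_mult_mod_eq using G(1) by simp
  have "poly (map_poly of_rat (u * v + w)) \<eta>
      = poly (map_poly of_rat u) \<eta> * poly (map_poly of_rat v) \<eta> + poly (map_poly of_rat w) \<eta>"
    for u v w :: "rat poly" by (simp add: hom_distribs)
  from 0[unfolded this g(3)] have "poly (map_poly of_rat (?G mod ?g)) \<eta> = 0" by simp
  moreover have "degree (?G mod ?g) < 3" using degree_mod_less[OF g(4), of ?G] g(1) by auto
  ultimately have "?G mod ?g = 0" using small_poly_at_elt[OF \<eta>(2) \<eta>(1)[symmetric]] by blast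
  then have "?g dvd ?G" by (simp add: dvd_eq_mod_eq_0)
  from monic_rat_divisor_is_int[OF G(2) g(2) this] obtain F :: "int poly" where F: "?g = map_poly of_int F" .
  have deg: "degree F = 3" using g(1) unfolding F by simp
  moreover have lead: "lead_coeff F = 1" using g(2) unfolding F by simp
  moreover have "poly (map_poly of_int F) \<eta> = 0"
    using g(3) unfolding F by (simp add: map_poly_map_poly o_def)
  ultimately have eq: "field_char_poly K \<eta> = F" using \<eta> field_char_poly_eqI by blast
  have "F = [:coeff F 0, coeff F 1, coeff F 2, 1:]"
  proof (rule poly_eqI)
    fix n
    show "coeff F n = coeff [:coeff F 0, coeff F 1, coeff F 2, 1:] n"
    proof (cases "n \<le> 3")
      case True
      then have "n = 0 \<or> n = 1 \<or> n = 2 \<or> n = 3" by linarith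
      then show ?thesis using lead deg by (auto simp: eval_nat_numeral)
    next
      case False
      then show ?thesis using deg by (simp add: coeff_eq_0 coeff_pCons split: nat.splits)
    qed
  qed
  then show ?thesis using that[OF \<eta>(2)] eq F by metis
qed

text \<open>A simple root modulo \<pi> is lifted to precision \<open>\<pi> ^ k\<close>. At the
  lifted point \<open>n\<close>, the identity for \<open>g\<close> and \<open>h\<close> makes
  \<open>poly g n / I\<close> an approximate root of the defining cubic, up to denominators.\<close>

lemma padic_root_exists:
  fixes c0 c1 c2 \<pi> n :: int
  assumes "q \<noteq> 0 \<or> r \<noteq> 0" "char_cubic p q r = map_poly of_int [:c0, c1, c2, 1:]"
    and "prime \<pi>" "\<pi> dvd poly [:c0, c1, c2, 1:] n" "\<not> \<pi> dvd 3 * n\<^sup>2 + 2 * c2 * n + c1"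
  shows "\<exists>y. \<pi> ^ k dvd y ^ 3 - a * y + b"
proof -
  let ?F = "[:c0, c1, c2, 1:]"
  define I where "I = index_form q r"
  have I: "I \<noteq> 0" unfolding I_def by (rule index_form_nonzero[OF assms(1)])
  obtain g h where gh: "\<And>x. poly g x ^ 3 - of_int a * poly g x * I\<^sup>2 + of_int b * I ^ 3
     = poly (char_cubic p q r) x * poly h x"
    using char_cubic_dvd unfolding I_def by blast
  obtain d g' where g': "d > 0" "map_poly of_int g' = Polynomial.smult (of_int d) g" using clear_denominators .
  obtain e h' where h': "e > 0" "map_poly of_int h' = Polynomial.smult (of_int e) h" using clear_denominators .
  obtain m l where I_eq: "I = of_int m / of_int l" "l > 0"
    by (metis quotient_of_denom_pos quotient_of_div surj_pair)
  have m0: "m \<noteq> 0" using I I_eq by auto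
  have val: "poly (map_poly of_int f') (of_int n) = (of_int (poly f' n) :: rat)" for f' n by simp
  show ?thesis
  proof (rule padic_root_clear_denominator[OF assms(3)])
    show "e \<noteq> 0" "d * m \<noteq> 0" using h' g' m0 by auto
    fix k
    obtain n where n: "\<pi> ^ k dvd poly ?F n" using hensel_cubic[OF assms(3-5)] by blast
    define U where "U = l * poly g' n"
    have "of_int (poly g' n) = of_int d * poly g (of_int n)"
      using val[of g' n] unfolding g' by simp
    then have gU: "of_int d * of_int l * poly g (of_int n) = of_int U" by (simp add: U_def)
    have hn: "of_int (poly h' n) = of_int e * poly h (of_int n)"
      using val[of h' n] unfolding h' by simp
    have lI: "of_int l * I = of_int m" using I_eq by simp
    have "of_int (e * (U ^ 3 - a * U * (d * m)\<^sup>2 + b * (d * m) ^ 3)) =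
       of_int e * (of_int d * of_int l) ^ 3 * (poly g (of_int n) ^ 3 - of_int a * poly g (of_int n) * I\<^sup>2 + of_int b * I ^ 3)"
      unfolding of_int_mult of_int_add of_int_diff of_int_power gU[symmetric] lI[symmetric]
      by (simp add: algebra_simps power2_eq_square power3_eq_cube)
    also have "\<dots> = of_int (poly ?F n) * ((of_int d * of_int l) ^ 3 * of_int (poly h' n))"
      unfolding gh assms(2) val hn by (simp add: algebra_simps)
    also have "\<dots> = of_int (poly ?F n * ((d * l) ^ 3 * poly h' n))" by simp
    finally have "e * (U ^ 3 - a * U * (d * m)\<^sup>2 + b * (d * m) ^ 3) = poly ?F n * ((d * l) ^ 3 * poly h' n)"
      by (simp only: of_int_eq_iff)
    then show "\<exists>U. \<pi> ^ k dvd e * (U ^ 3 - a * U * (d * m)\<^sup>2 + b * (d * m) ^ 3)"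
      using n by (metis dvd_mult2)
  qed
qed

end

section \<open>Local conditions at 2 and 3\<close>

lemma prime_power_times_unique:
  fixes p x y :: int
  assumes "prime p" "p ^ s * x = p ^ t * y" "\<not> p dvd x" "\<not> p dvd y"
  shows "s = t" "x = y"
proof -
  have p0: "p \<noteq> 0" using assms(1) by auto
  have le: "t \<le> s" if "p ^ s * x = p ^ t * y" "\<not> p dvd x" for s t x y
  proof (rule ccontr)
    assume "\<not> t \<le> s"
    then obtain l where "t = s + Suc l" using less_iff_Suc_add[of s t] by auto
    then have "p ^ s * x = p ^ s * (p * (p ^ l * y))" using that(1) by (simp add: power_add)
    then have "x = p * (p ^ l * y)" using p0 by simp
    then show False using that(2) by simp
  qed
  show "s = t" using le[OF assms(2,3)] le[OF assms(2)[symmetric] assms(4)] by simp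
  then show "x = y" using assms(2) p0 by simp
qed

lemma not_dvd_3_square_mod:
  fixes x :: int
  assumes "\<not> 3 dvd x"
  shows "[x\<^sup>2 = 1] (mod 3)"
proof -
  have "x mod 3 = 1 \<or> x mod 3 = 2" using assms by presburger
  then show ?thesis by (auto simp: cong_def power_mod[of x 3 2, symmetric])
qed

text \<open>\<open>D\<close> and \<Delta> differ by the square of \<open>u / v\<close>. Comparing
  powers of 3 makes \<open>s\<close> even; the squares that remain are prime to 3, hence 1 modulo
  3.\<close>

lemma square_ratio_mod_3:
  fixes u v D \<Delta> \<Delta>3 :: int
  assumes "v\<^sup>2 * D = u\<^sup>2 * \<Delta>" "u \<noteq> 0" "v \<noteq> 0" "[D = 1] (mod 3)" "\<Delta> = 3 ^ s * \<Delta>3" "\<not> 3 dvd \<Delta>3"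
  shows "even s" "[\<Delta>3 = 1] (mod 3)"
proof -
  have p3: "prime (3::int)" by simp
  obtain i v' where v: "v = 3 ^ i * v'" "\<not> 3 dvd v'"
    using multiplicity_decompose'[of v 3] assms(3) by (metis not_prime_unit p3)
  obtain j u' where u: "u = 3 ^ j * u'" "\<not> 3 dvd u'"
    using multiplicity_decompose'[of u 3] assms(2) by (metis not_prime_unit p3)
  have D: "\<not> 3 dvd D" using assms(4) cong_dvd_iff[of D 1 3] by auto
  have eq: "3 ^ (2 * i) * (v'\<^sup>2 * D) = 3 ^ (2 * j + s) * (u'\<^sup>2 * \<Delta>3)"
    using assms(1) unfolding v(1) u(1) assms(5) power_mult_distrib power_even_eq power_add
    by (simp only: ac_simps)
  have nd: "\<not> 3 dvd v'\<^sup>2 * D" "\<not> 3 dvd u'\<^sup>2 * \<Delta>3"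
    using u(2) v(2) D assms(6) p3 by (auto simp: prime_dvd_mult_iff prime_dvd_power_iff)
  have e: "2 * i = 2 * j + s" "v'\<^sup>2 * D = u'\<^sup>2 * \<Delta>3"
    using prime_power_times_unique[OF p3 eq nd] by auto
  show "even s" using e(1) by presburger
  have "[u'\<^sup>2 * \<Delta>3 = 1 * \<Delta>3] (mod 3)" by (intro cong_mult not_dvd_3_square_mod u cong_refl)
  moreover have "[v'\<^sup>2 * D = 1 * 1] (mod 3)" by (intro cong_mult not_dvd_3_square_mod v assms)
  ultimately show "[\<Delta>3 = 1] (mod 3)" using e(2) by (metis cong_sym cong_trans mult_1)
qed

text \<open>A root modulo 8 forces \<open>a\<close>, \<open>b\<close> and \<open>y\<close> to be
  even. Then 4 divides \<open>b\<close>, by the second hypothesis 4 divides \<open>a\<close>, and so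
  8 divides \<open>b\<close>, against the third.\<close>

lemma no_root_mod_8:
  fixes a b y :: int
  assumes "even a \<longleftrightarrow> even b" "\<not> (even a \<and> \<not> 4 dvd a \<and> 4 dvd b)" "\<not> (4 dvd a \<and> 8 dvd b)"
  shows "\<not> 8 dvd y ^ 3 - a * y + b"
proof
  assume d: "8 dvd y ^ 3 - a * y + b"
  then have ev: "even (y ^ 3 - a * y + b)" by (meson dvd_trans even_numeral)
  have ab: "even a" "even b" using ev assms(1) by auto
  then have "even y" using ev by auto
  then obtain z c where z: "y = 2 * z" "a = 2 * c" using ab by (auto elim!: evenE)
  have d8: "8 dvd b - 4 * (c * z)"
  proof -
    have "b - 4 * (c * z) = (y ^ 3 - a * y + b) - 8 * z ^ 3" unfolding z by (simp add: power3_eq_cube)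
    then show ?thesis using d by (metis dvd_diff dvd_triv_left)
  qed
  then have "4 dvd b" by presburger
  then have "4 dvd a" using assms ab by auto
  then have "even c" unfolding z by presburger
  then obtain t where "c * z = 2 * t" by (metis evenE even_mult_iff)
  then have "8 dvd b" using d8 by presburger
  then show False using assms \<open>4 dvd a\<close> by blast
qed

lemma root_mod_81:
  fixes a b y \<Delta>3 :: int
  assumes D: "4 * a ^ 3 - 27 * b\<^sup>2 = 3 ^ s * \<Delta>3" "even s" "[\<Delta>3 = 1] (mod 3)"
    and y: "81 dvd y ^ 3 - a * y + b" and ab: "\<not> (9 dvd a \<and> 27 dvd b)"
  shows "[a = 1] (mod 3) \<and> 3 dvd b
    \<or> [a = 3] (mod 9) \<and> [b\<^sup>2 = a + 1] (mod 27) \<and> s > 6"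
proof -
  have p3: "prime (3::int)" by simp
  have nd: "\<not> 3 dvd \<Delta>3" using D(3) cong_dvd_iff[of \<Delta>3 1 3] by auto
  have uniq: "s = t \<and> x = \<Delta>3" if "4 * a ^ 3 - 27 * b\<^sup>2 = 3 ^ t * x" "\<not> 3 dvd x" for t x
    using prime_power_times_unique[OF p3 _ that(2) nd, of t s] that(1) D(1) by auto
  have "a mod 3 = 0 \<or> a mod 3 = 1 \<or> a mod 3 = 2" by presburger
  then consider (0) "a mod 3 = 0" | (1) "a mod 3 = 1" | (2) "a mod 3 = 2" by blast
  then show ?thesis
  proof cases
    case 1
    then obtain c where c: "a = 3 * c + 1" by (metis mult_div_mod_eq)
    have "3 dvd y ^ 3 - a * y + b" using y by (rule dvd_trans[rotated]) simp
    moreover have "3 dvd y ^ 3 - y"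
    proof -
      have "y mod 3 = 0 \<or> y mod 3 = 1 \<or> y mod 3 = 2" by presburger
      then have "(y mod 3) ^ 3 mod 3 = y mod 3" by auto
      then show ?thesis by (simp add: power_mod mod_eq_dvd_iff)
    qed
    moreover have "b = (y ^ 3 - a * y + b) - (y ^ 3 - y) + 3 * (c * y)" unfolding c by (simp add: algebra_simps)
    ultimately have "3 dvd b" by (metis dvd_add dvd_diff dvd_triv_left)
    then show ?thesis using 1 by (simp add: cong_def)
  next
    case 2
    then obtain c where c: "a = 3 * c + 2" by (metis mult_div_mod_eq)
    \<comment> \<open>Here \<Delta> is 2 modulo 3, so it equals \<open>\<Delta>3\<close> and
      contradicts \<open>\<Delta>3\<close> being 1.\<close>
    define x where "x = 4 * a ^ 3 - 27 * b\<^sup>2"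
    have "x = 3 * (36 * c ^ 3 + 72 * c\<^sup>2 + 48 * c + 10 - 9 * b\<^sup>2) + 2"
      unfolding x_def c by (simp add: algebra_simps power2_eq_square power3_eq_cube)
    then obtain N where "x = 3 * N + 2" by blast
    then have x3: "\<not> 3 dvd x" "x mod 3 = 2" by presburger+
    then have "x = \<Delta>3" using uniq[of 0 x] x_def by simp
    then show ?thesis using D(3) x3 by (simp add: cong_def)
  next
    case 0
    then obtain c where c: "a = 3 * c" by auto
    have "3 dvd y ^ 3 - a * y + b" using y by (rule dvd_trans[rotated]) simp
    moreover have "y ^ 3 + b = (y ^ 3 - a * y + b) + 3 * (c * y)" unfolding c by simp
    ultimately have y3b: "3 dvd y ^ 3 + b" by (metis dvd_add dvd_triv_left)
    show ?thesis
    proof (cases "3 dvd b")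
      case True
      then have "3 dvd y ^ 3" using y3b by (simp add: dvd_add_left_iff)
      then have "3 dvd y" using prime_dvd_power[OF p3] by blast
      then obtain z where z: "y = 3 * z" by blast
      define t where "t = c * z"
      have b27: "27 dvd b - 9 * t"
      proof -
        have "27 dvd y ^ 3 - a * y + b" using y by (rule dvd_trans[rotated]) simp
        moreover have "b - 9 * t = (y ^ 3 - a * y + b) - 27 * z ^ 3"
          unfolding t_def c z by (simp add: power3_eq_cube)
        ultimately show ?thesis by (metis dvd_diff dvd_triv_left)
      qed
      then have "9 dvd b" by presburger
      then obtain b' where b': "b = 9 * b'" by blast
      have bt: "3 dvd b' - t" using b27 unfolding b' by presburger
      have "\<not> 3 dvd c"
      proof
        assume c3: "3 dvd c"
        then have "3 dvd t" by (simp add: t_def)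
        then have "3 dvd b'" using bt by presburger
        then show False using ab c3 unfolding b' c by auto
      qed
      then have "\<not> 3 dvd 4 * c ^ 3" using p3 by (simp add: prime_dvd_mult_iff prime_dvd_power_iff)
      then have "\<not> 3 dvd 4 * c ^ 3 - 3 * (27 * b'\<^sup>2)"
        using dvd_add[of 3 "4 * c ^ 3 - 3 * (27 * b'\<^sup>2)" "3 * (27 * b'\<^sup>2)"] by auto
      moreover have "4 * a ^ 3 - 27 * b\<^sup>2 = 3 ^ 3 * (4 * c ^ 3 - 3 * (27 * b'\<^sup>2))"
        unfolding c b' by (simp add: power2_eq_square power3_eq_cube)
      ultimately have "s = 3" using uniq by blast
      then show ?thesis using D(2) by simp
    next
      case False
      have ynd: "\<not> 3 dvd y" using False y3b by (auto simp: dvd_add_right_iff power3_eq_cube)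
      have b2: "[b\<^sup>2 = 1] (mod 3)" by (rule not_dvd_3_square_mod[OF False])
      have eq: "4 * a ^ 3 - 27 * b\<^sup>2 = 3 ^ 3 * (4 * c ^ 3 - b\<^sup>2)"
        unfolding c by (simp add: power2_eq_square power3_eq_cube)
      have "s \<noteq> 3" using D(2) by auto
      then have "3 dvd 4 * c ^ 3 - b\<^sup>2" using uniq[OF eq] by blast
      then have "(4 * c ^ 3) mod 3 = b\<^sup>2 mod 3" by (simp only: mod_eq_dvd_iff)
      then have c3: "(4 * c ^ 3) mod 3 = 1" using b2 by (simp add: cong_def)
      have "c mod 3 = 1"
      proof -
        have "c mod 3 = 0 \<or> c mod 3 = 1 \<or> c mod 3 = 2" by presburger
        moreover have "(4 * (c mod 3) ^ 3) mod 3 = 1" using c3 by (metis mod_mult_right_eq power_mod)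
        ultimately show ?thesis by auto
      qed
      then obtain m where "c = 3 * m + 1" by (metis mult_div_mod_eq)
      then have a: "a = 3 + 9 * m" using c by simp
      \<comment> \<open>\<open>e\<close> is the sign with which \<open>y\<close> reduces modulo 3;
        below, \<open>z\<close> is chosen so that \<open>y = e * (1 + 3 * z)\<close>.\<close>
      obtain e k where e: "e\<^sup>2 = 1" and y_eq: "y = e + 3 * k"
      proof -
        have "y mod 3 = 1 \<or> y mod 3 = 2" using ynd by presburger
        then show ?thesis
        proof
          assume "y mod 3 = 1"
          then have "y = 1 + 3 * (y div 3)" using mult_div_mod_eq[of 3 y] by linarith
          then show ?thesis by (rule that[rotated]) simp
        next
          assume "y mod 3 = 2"
          then have "3 * (y div 3) + 2 = y" using mult_div_mod_eq[of 3 y] by simp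
          then have "y = - 1 + 3 * (y div 3 + 1)" by (simp add: algebra_simps)
          then show ?thesis by (rule that[rotated]) simp
        qed
      qed
      have e3: "e ^ 3 = e" using e by (simp add: power2_eq_square power3_eq_cube)
      obtain j where j: "y ^ 3 - a * y + b = 81 * j" using y by blast
      define z where "z = e * k"
      have k: "k = e * z" using e by (simp add: z_def power2_eq_square mult.assoc[symmetric])
      have b: "b = e * (2 + 9 * m - 27 * (z\<^sup>2 + z ^ 3 - m * z) + 81 * (e * j))"
      proof -
        have "y = e * (1 + 3 * z)" unfolding y_eq k by (simp add: algebra_simps)
        then have "y ^ 3 = e * (1 + 3 * z) ^ 3" using e3 by (simp add: power_mult_distrib)
        then have "b = 81 * j * e\<^sup>2 - e * (1 + 3 * z) ^ 3 + a * (e * (1 + 3 * z))"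
          using j \<open>y = e * (1 + 3 * z)\<close> e by simp
        then show ?thesis unfolding a by (simp add: algebra_simps power2_eq_square power3_eq_cube)
      qed
      \<comment> \<open>The root modulo 81 determines \<open>w\<close> modulo 3 in terms of
        \<open>m\<close> and \<open>z\<close>.\<close>
      define w where "w = z\<^sup>2 + z ^ 3 - m * z - 3 * (e * j)"
      have b': "b = e * (2 + 9 * m - 27 * w)" unfolding b w_def by (simp add: algebra_simps)
      define n where "n = m - 4 * w + 3 * (m\<^sup>2 + 9 * w\<^sup>2 - 6 * m * w)"
      have bsq: "b\<^sup>2 = a + 1 + 27 * n"
      proof -
        have "b\<^sup>2 = (2 + 9 * m - 27 * w)\<^sup>2" unfolding b' power_mult_distrib e by simp
        then show ?thesis unfolding a n_def by (simp add: algebra_simps power2_eq_square)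
      qed
      define x where "x = m + 4 * m\<^sup>2 + 4 * m ^ 3 - n"
      have D6: "4 * a ^ 3 - 27 * b\<^sup>2 = 3 ^ 6 * x"
        unfolding bsq unfolding a x_def by (simp add: algebra_simps power2_eq_square power3_eq_cube)
      \<comment> \<open>Since \<Delta> is \<open>3 ^ 6 * x\<close>, failure would mean
        \<open>s = 6\<close> and \<open>x\<close> congruent to 1. Modulo 3, however,
        \<open>x\<close> is a polynomial in \<open>m\<close> and \<open>z\<close> that never takes
        the value 1.\<close>
      have "s > 6"
      proof (rule ccontr)
        assume "\<not> s > 6"
        then have s6: "s \<le> 6" by simp
        have "3 ^ s * \<Delta>3 = 3 ^ s * (3 ^ (6 - s) * x)" using D(1) D6 s6
          by (simp add: power_add[symmetric] mult.assoc[symmetric])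
        then have "\<Delta>3 = 3 ^ (6 - s) * x" by simp
        then have "6 - s = 0" using nd by (cases "6 - s") auto
        then have "[x = 1] (mod 3)" using \<open>\<Delta>3 = 3 ^ (6 - s) * x\<close> D(3) by simp
        moreover have "x = (m\<^sup>2 + m ^ 3 + z\<^sup>2 + z ^ 3 - m * z) + 3 * (m\<^sup>2 + m ^ 3 - 4 * (e * j) + (z\<^sup>2 + z ^ 3 - m * z) - (m\<^sup>2 + 9 * w\<^sup>2 - 6 * m * w))"
          unfolding x_def n_def by (simp add: w_def algebra_simps)
        then have "x mod 3 = (m\<^sup>2 + m ^ 3 + z\<^sup>2 + z ^ 3 - m * z) mod 3"
          by (simp only: mod_mult_self2)
        moreover have "[(m mod 3)\<^sup>2 + (m mod 3) ^ 3 + (z mod 3)\<^sup>2 + (z mod 3) ^ 3 - (m mod 3) * (z mod 3)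
            = m\<^sup>2 + m ^ 3 + z\<^sup>2 + z ^ 3 - m * z] (mod 3)"
          by (intro cong_add cong_diff cong_mult cong_pow) (simp_all add: cong_def)
        ultimately have r: "((m mod 3)\<^sup>2 + (m mod 3) ^ 3 + (z mod 3)\<^sup>2 + (z mod 3) ^ 3 - (m mod 3) * (z mod 3)) mod 3 = 1"
          unfolding cong_def by simp
        have "m mod 3 = 0 \<or> m mod 3 = 1 \<or> m mod 3 = 2" "z mod 3 = 0 \<or> z mod 3 = 1 \<or> z mod 3 = 2"
          by presburger+
        then show False using r by auto
      qed
      moreover have "[a = 3] (mod 9)" unfolding a by (simp add: cong_def)
      moreover have "[b\<^sup>2 = a + 1] (mod 27)" unfolding bsq by (simp add: cong_def)
      ultimately show ?thesis by blast
    qed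
  qed
qed

text \<open>If \<open>X\<close> is the root \<open>\<theta> - \<rho>\<close> of \<open>X\<^sup>3 + 3 \<rho> X\<^sup>2 + (3 \<rho>\<^sup>2 - a) X + (\<rho>\<^sup>3 - a \<rho> + b)\<close>, these data make
  \<open>t = - D / X\<close> a root of \<open>t\<^sup>3 - 3 e t\<^sup>2 + c1 t - c0\<close>, which is \<open>t\<^sup>3 - t\<close> modulo 3. The integer \<open>\<rho>\<close> is a
  \<open>3\<close>-adic approximation of \<open>sqrt (a / 3)\<close>, near which two of the three \<open>3\<close>-adic roots lie.\<close>

lemma split_witness:
  fixes a b \<Delta>3 :: int
  assumes \<Delta>: "4 * a ^ 3 - 27 * b\<^sup>2 = 3 ^ s * \<Delta>3" "even s" "s > 6" "[\<Delta>3 = 1] (mod 3)"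
    and a: "[a = 3] (mod 9)"
  obtains \<rho> N D c0 c1 e :: int where "N \<noteq> 0" "D \<noteq> 0" "3 * \<rho>\<^sup>2 - a = 3 * N * e"
    "\<rho> ^ 3 - a * \<rho> + b = N * D" "3 * \<rho> * D = N * c1" "D\<^sup>2 = N * c0" "3 dvd c0" "[c1 = - 1] (mod 3)"
proof -
  have p3: "prime (3::int)" by simp
  \<comment> \<open>That \<open>m\<close> is positive will make \<open>c0\<close> divisible by
    3.\<close>
  obtain m where s: "s = 2 * m + 6" and m: "m > 0"
  proof -
    obtain k where "s = 2 * k" using \<Delta>(2) by blast
    then show ?thesis using that[of "k - 3"] \<Delta>(3) by auto
  qed
  define c where "c = a div 3"
  have "a mod 9 = 3" using a by (simp add: cong_def)
  then have c: "a = 3 * c" "c mod 3 = 1" unfolding c_def by presburger+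
  have c3: "\<not> 3 dvd c" using c(2) by presburger
  have s27: "(3::int) ^ s = 27 * 3 ^ (2 * m + 3)" unfolding s by (simp add: power_add)
  have "27 * (4 * c ^ 3 - b\<^sup>2) = 27 * (3 ^ (2 * m + 3) * \<Delta>3)"
    using \<Delta>(1) unfolding s27 c(1) by (simp add: power_mult_distrib algebra_simps)
  then have cb: "4 * c ^ 3 = b\<^sup>2 + 3 * (3 ^ (2 * m + 2) * \<Delta>3)" by (simp add: power_add)
  have b3: "\<not> 3 dvd b"
  proof
    assume "3 dvd b"
    then have "3 dvd 4 * c ^ 3" unfolding cb by (simp add: power2_eq_square)
    then show False using c3 p3 by (simp add: prime_dvd_mult_iff prime_dvd_power_iff)
  qed
  have bc: "3 dvd b\<^sup>2 - c"
    using not_dvd_3_square_mod[OF b3] c(2) by (simp add: cong_def mod_eq_dvd_iff[symmetric])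
  \<comment> \<open>Modulo 3, \<open>- b\<close> is a nonzero simple root of
    \<open>X ^ 3 - c * X\<close>, so the lifted \<rho> is a square root of \<open>c\<close> modulo
    \<open>3 ^ s\<close>. The sign is chosen to make \<open>B\<close> below divisible by 3.\<close>
  have "3 dvd poly [:0, - c, 0, 1:] (- b)"
  proof -
    have "poly [:0, - c, 0, 1:] (- b) = - b * (b\<^sup>2 - c)" by (simp add: power2_eq_square algebra_simps)
    from this bc show ?thesis by (simp only: dvd_mult)
  qed
  moreover have "\<not> 3 dvd 3 * (- b)\<^sup>2 + 2 * 0 * (- b) + - c"
    using c3 dvd_add_right_iff[of 3 "3 * (- b)\<^sup>2" "- c"] by simp
  ultimately obtain \<rho> where \<rho>: "3 ^ s dvd poly [:0, - c, 0, 1:] \<rho>" "[\<rho> = - b] (mod 3)"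
    using hensel_cubic[OF p3, of 0 "- c" 0 "- b" s] by blast
  have \<rho>3: "\<not> 3 dvd \<rho>" using b3 \<rho>(2) cong_dvd_iff[of \<rho> "- b" 3] by auto
  then have cop: "coprime (3 ^ s) \<rho>" using p3 by (simp add: prime_imp_coprime)
  have "poly [:0, - c, 0, 1:] \<rho> = \<rho> * (\<rho>\<^sup>2 - c)" by (simp add: power2_eq_square algebra_simps)
  then have "3 ^ s dvd \<rho>\<^sup>2 - c" using \<rho>(1) by (simp only: coprime_dvd_mult_right_iff[OF cop])
  then obtain E where E: "\<rho>\<^sup>2 - c = 3 ^ s * E" by blast
  \<comment> \<open>\<open>A\<close> and \<open>B\<close> are the derivative and the value of
    \<open>X ^ 3 - a * X + b\<close> at \<rho>; the choice of \<rho> makes \<open>A\<close>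
    divisible by \<open>3 * 3 ^ s\<close>.\<close>
  define A where "A = 3 * \<rho>\<^sup>2 - a"
  define B where "B = \<rho> ^ 3 - a * \<rho> + b"
  have A: "A = 3 * 3 ^ s * E" using E unfolding A_def c(1) by simp
  \<comment> \<open>The cofactor of \<open>A\<close> when the discriminant is rewritten in terms of
    \<open>A\<close>, \<open>B\<close> and \<rho>. The identity shows that 3 divides
    \<open>B\<close> exactly \<open>2 * m + 3\<close> times.\<close>
  define H where "H = 9 * \<rho>\<^sup>2 * A - 4 * A\<^sup>2 + 54 * B * \<rho>"
  define w where "w = 3 * (E * H) - \<Delta>3"
  have "a = 3 * \<rho>\<^sup>2 - A" "b = B + 2 * \<rho> ^ 3 - A * \<rho>"
    by (simp_all add: A_def B_def algebra_simps power2_eq_square power3_eq_cube)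
  then have "4 * a ^ 3 - 27 * b\<^sup>2 + 27 * (B * (B + 4 * \<rho> ^ 3)) = A * H"
    unfolding H_def by (simp only:) (simp add: algebra_simps eval_nat_numeral)
  moreover have "A * H = 3 ^ s * (3 * (E * H))" by (simp add: A)
  ultimately have "27 * (B * (B + 4 * \<rho> ^ 3)) = 3 ^ s * w"
    unfolding \<Delta>(1) w_def right_diff_distrib by linarith
  then have Bw: "B * (B + 4 * \<rho> ^ 3) = 3 ^ (2 * m + 3) * w" unfolding s27 by simp
  have "[B = \<rho> - 0 * \<rho> + b] (mod 3)" unfolding B_def
  proof (intro cong_add cong_diff cong_mult cong_refl)
    have "[\<rho> * \<rho>\<^sup>2 = \<rho> * 1] (mod 3)" by (intro cong_mult cong_refl not_dvd_3_square_mod \<rho>3)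
    then show "[\<rho> ^ 3 = \<rho>] (mod 3)" by (simp add: power3_eq_cube power2_eq_square mult.assoc)
  qed (simp add: c(1) cong_def)
  moreover have "[\<rho> + b = - b + b] (mod 3)" by (intro cong_add cong_refl \<rho>)
  ultimately have B3: "[B = 0] (mod 3)" using cong_trans by fastforce
  have Br: "[B + 4 * \<rho> ^ 3 = \<rho>] (mod 3)"
  proof -
    have "[B + 4 * (\<rho> * \<rho>\<^sup>2) = 0 + 1 * (\<rho> * 1)] (mod 3)"
      by (intro cong_add cong_mult cong_refl not_dvd_3_square_mod \<rho>3 B3) (simp add: cong_def)
    then show ?thesis by (simp add: power3_eq_cube power2_eq_square mult.assoc)
  qed
  then have "\<not> 3 dvd B + 4 * \<rho> ^ 3" using \<rho>3 cong_dvd_iff by blast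
  then have "coprime (3 ^ (2 * m + 3)) (B + 4 * \<rho> ^ 3)"
    using p3 by (simp add: prime_imp_coprime)
  moreover have "3 ^ (2 * m + 3) dvd B * (B + 4 * \<rho> ^ 3)" unfolding Bw by simp
  ultimately have "3 ^ (2 * m + 3) dvd B" by (simp only: coprime_dvd_mult_left_iff)
  then obtain f where f: "B = 3 ^ (2 * m + 3) * f" by blast
  have "3 ^ (2 * m + 3) * (f * (B + 4 * \<rho> ^ 3)) = 3 ^ (2 * m + 3) * w"
    using Bw by (subst (asm) (1) f) (simp only: mult.assoc)
  then have fw: "f * (B + 4 * \<rho> ^ 3) = w" by simp
  have w1: "[w = 0 - 1] (mod 3)" unfolding w_def
    by (intro cong_diff \<Delta>(4)) (simp add: cong_def)
  have "[f * \<rho> = f * (B + 4 * \<rho> ^ 3)] (mod 3)" by (intro cong_mult cong_refl cong_sym[OF Br])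
  then have fr: "[\<rho> * f = - 1] (mod 3)"
    using cong_trans[OF _ w1] unfolding fw by (simp add: mult.commute)
  have f0: "f \<noteq> 0"
  proof
    assume "f = 0"
    then have "[0 = - 1] (mod (3::int))" using fr by simp
    then show False by (simp add: cong_def)
  qed
  define t where "t = (3::int) ^ m"
  have t: "t \<noteq> 0" "3 dvd t" using m by (simp_all add: t_def)
  have pow: "(3::int) ^ s = t * t * 729" "(3::int) ^ (2 * m + 3) = t * t * 27"
    by (simp_all only: s t_def power_add mult_2) simp_all
  show ?thesis
  \<comment> \<open>As \<open>s\<close> is even, \<open>B = 27 * t * t * f\<close> splits into
    \<open>N = 9 * t\<close> and \<open>D = 3 * t * f\<close>, with \<open>N\<close> dividing both
    \<open>D\<^sup>2\<close> and \<open>3 * \<rho> * D\<close>.\<close>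
  proof (rule that[of "9 * t" "3 * t * f" \<rho> "81 * t * E" "\<rho> * f" "t * f\<^sup>2"])
    show "3 * \<rho>\<^sup>2 - a = 3 * (9 * t) * (81 * t * E)"
      unfolding A_def[symmetric] A pow by simp
    show "\<rho> ^ 3 - a * \<rho> + b = 9 * t * (3 * t * f)"
      unfolding B_def[symmetric] f pow by simp
    show "3 * \<rho> * (3 * t * f) = 9 * t * (\<rho> * f)" by simp
    show "(3 * t * f)\<^sup>2 = 9 * t * (t * f\<^sup>2)"
      by (simp add: power2_eq_square)
    show "3 dvd t * f\<^sup>2" using t by simp
    show "9 * t \<noteq> 0" "3 * t * f \<noteq> 0" using t f0 by simp_all
    show "[\<rho> * f = - 1] (mod 3)" by (rule fr)
  qed
qed

section \<open>The greatest common divisors of the values\<close>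

text \<open>The values at 0 and 1, and for the prime 3 also at -1, force the congruences.
  Conversely, modulo 3 the cubic becomes \<open>x ^ 3 - x\<close>, which vanishes by Fermat's little
  theorem.\<close>

lemma dvd_cubic_values_iff:
  fixes c0 c1 c2 :: int
  shows "2 dvd Gcd (range (poly [:c0, c1, c2, 1:])) \<longleftrightarrow> even c0 \<and> odd (c1 + c2)"
    and "3 dvd Gcd (range (poly [:c0, c1, c2, 1:])) \<longleftrightarrow> 3 dvd c0 \<and> 3 dvd c2 \<and> [c1 = - 1] (mod 3)"
proof -
  let ?F = "poly [:c0, c1, c2, 1:]"
  have all: "p dvd Gcd (range ?F) \<longleftrightarrow> (\<forall>x. p dvd ?F x)" for p
    by (auto simp: dvd_Gcd_iff)
  have F: "?F x = c0 + x * c1 + x * (x * c2) + x * (x * x)" for x by (simp add: algebra_simps)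
  show "2 dvd Gcd (range ?F) \<longleftrightarrow> even c0 \<and> odd (c1 + c2)"
  proof
    assume "2 dvd Gcd (range ?F)"
    then have "2 dvd ?F 0" "2 dvd ?F 1" unfolding all by blast+
    then show "even c0 \<and> odd (c1 + c2)" by auto
  next
    assume "even c0 \<and> odd (c1 + c2)"
    then have "even (?F x)" for x unfolding F by auto
    then show "2 dvd Gcd (range ?F)" unfolding all by blast
  qed
  show "3 dvd Gcd (range ?F) \<longleftrightarrow> 3 dvd c0 \<and> 3 dvd c2 \<and> [c1 = - 1] (mod 3)"
  proof
    assume "3 dvd Gcd (range ?F)"
    then have "3 dvd ?F 0" "3 dvd ?F 1" "3 dvd ?F (- 1)" unfolding all by blast+
    then have "3 dvd c0" "3 dvd c0 + c1 + c2 + 1" "3 dvd c0 - c1 + c2 - 1" by (simp_all add: algebra_simps)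
    then show "3 dvd c0 \<and> 3 dvd c2 \<and> [c1 = - 1] (mod 3)" unfolding cong_iff_dvd_diff by presburger
  next
    assume *: "3 dvd c0 \<and> 3 dvd c2 \<and> [c1 = - 1] (mod 3)"
    have "[?F x = 0] (mod 3)" for x
    proof -
      have "[?F x = 0 + x * (- 1) + x * (x * 0) + x * (x * x)] (mod 3)"
        unfolding F by (intro cong_add cong_mult cong_refl) (use * in \<open>simp_all add: cong_0_iff\<close>)
      moreover have "[x * (x * x) = x] (mod 3)"
      proof (cases "3 dvd x")
        case True
        then show ?thesis by (simp add: cong_iff_dvd_diff)
      next
        case False
        then show ?thesis
          using cong_mult[OF cong_refl not_dvd_3_square_mod[OF False], of x] by (simp add: power2_eq_square)
      qed
      then have "[0 + x * (- 1) + x * (x * 0) + x * (x * x) = 0 + x * (- 1) + x * (x * 0) + x] (mod 3)"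
        by (intro cong_add cong_refl)
      ultimately show ?thesis using cong_trans by fastforce
    qed
    then show "3 dvd Gcd (range ?F)" unfolding all cong_0_iff by blast
  qed
qed

lemma cubic_value_gcd_dvd_6: "Gcd (range (poly [:c0, c1, c2, 1 :: int:])) dvd 6"
proof -
  let ?F = "poly [:c0, c1, c2, 1:]"
  have "Gcd (range ?F) dvd ?F x" for x by (rule Gcd_dvd) simp
  then have "Gcd (range ?F) dvd ?F 3 - 3 * ?F 2 + 3 * ?F 1 - ?F 0"
    by (intro dvd_diff dvd_add dvd_mult)
  then show ?thesis by simp
qed

section \<open>Primitive integers attaining the factors 2 and 3\<close>

context cubic_field
begin

text \<open>Eliminating \<open>\<theta>\<^sup>2\<close> between \<open>?\<xi>\<close> and its square
  leaves a nonzero rational multiple of \<theta>, with factor \<open>index_form q r\<close>.\<close>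

lemma theta_in_rat_adjoin:
  assumes "q \<noteq> 0 \<or> r \<noteq> 0"
  shows "\<theta> \<in> rat_adjoin (elt p q r)"
proof -
  let ?K = "rat_adjoin (elt p q r)" and ?\<xi> = "elt 0 q r" and ?I = "index_form q r"
  have sub: "is_subfield ?K" by (rule is_subfield_rat_adjoin)
  have I: "?I \<noteq> 0" by (rule index_form_nonzero[OF assms])
  have \<xi>: "?\<xi> \<in> ?K"
  proof -
    have "?\<xi> = elt p q r - of_rat p" by (simp add: elt_def)
    then show ?thesis
      using is_subfieldD(3)[OF sub in_rat_adjoin_self is_subfield_of_rat[OF sub, of p]] by simp
  qed
  define u where "u = of_rat (q\<^sup>2 + of_int a * r\<^sup>2) * ?\<xi> - of_rat r * (?\<xi> * ?\<xi>) - of_rat (2 * of_int b * q * r\<^sup>2)"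
  have scale: "of_rat c * elt p' q' r' = elt (c * p') (c * q') (c * r')" for c p' q' r'
    by (simp add: elt_def of_rat_mult algebra_simps)
  have of: "of_rat c = elt c 0 0" for c by (simp add: elt_def)
  have "u = elt 0 ?I 0"
    unfolding u_def of[of "2 * of_int b * q * r\<^sup>2"] elt_mult scale elt_diff elt_eq_iff index_form_def
    by (simp add: algebra_simps power2_eq_square power3_eq_cube)
  then have theta: "u / of_rat ?I = \<theta>" using I by (simp add: elt_def)
  have "u / of_rat ?I \<in> ?K"
    unfolding u_def by (intro is_subfieldD[OF sub] is_subfield_of_rat[OF sub] \<xi>)
  then show ?thesis unfolding theta .
qed

lemma primitive_integer_elt:
  assumes "q \<noteq> 0 \<or> r \<noteq> 0" "of_int c2 = tr1 q r" "of_int c1 = tr2 q r" "of_int c0 = tr3 q r"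
  shows "elt 0 q r \<in> primitive_integers K" "field_char_poly K (elt 0 q r) = [:c0, c1, c2, 1:]"
proof -
  have "char_cubic 0 q r = map_poly of_int [:c0, c1, c2, 1:]"
    using assms by (simp add: char_cubic_def hom_distribs)
  then have "poly (map_poly of_rat (map_poly of_int [:c0, c1, c2, 1:])) (elt 0 q r) = 0"
    using char_cubic_root[of 0 q r] by simp
  then have "elt 0 q r ^ 3 + of_int c2 * (elt 0 q r)\<^sup>2 + of_int c1 * elt 0 q r + of_int c0 = 0"
    by (simp add: hom_distribs algebra_simps power2_eq_square power3_eq_cube)
  from primitive_integerI[OF elt_in_K theta_in_rat_adjoin[OF assms(1)] this]
  show "elt 0 q r \<in> primitive_integers K" "field_char_poly K (elt 0 q r) = [:c0, c1, c2, 1:]" by auto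
qed

lemma two_dvd_value_gcd:
  assumes "odd (a + b) \<or> (even a \<and> \<not> 4 dvd a \<and> 4 dvd b)"
  obtains \<eta> where "\<eta> \<in> primitive_integers K" "2 dvd value_gcd K \<eta>"
proof -
  note goal = that
  have found: thesis if "q \<noteq> 0 \<or> r \<noteq> 0" "of_int c2 = tr1 q r" "of_int c1 = tr2 q r" "of_int c0 = tr3 q r"
    "even c0" "odd (c1 + c2)" for q r c0 c1 c2
  proof (rule goal[OF primitive_integer_elt(1)[OF that(1-4)]])
    show "2 dvd value_gcd K (elt 0 q r)"
      unfolding value_gcd_def primitive_integer_elt(2)[OF that(1-4)] dvd_cubic_values_iff using that by blast
  qed
  consider "odd a" "even b" | "even a" "odd b" | "even a" "\<not> 4 dvd a" "4 dvd b" using assms by auto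
  then show thesis
  proof cases
    case 1
    then show thesis by (intro found[of 1 0 0 "- a" b]) (simp_all add: tr1_def tr2_def tr3_def)
  next
    case 2
    then show thesis
      by (intro found[of 1 1 "- 2 * a" "a\<^sup>2 - a + 3 * b" "b * (1 - a - b)"])
        (simp_all add: tr1_def tr2_def tr3_def)
  next
    case 3
    then obtain a' b' where ab: "a = 2 * a'" "b = 4 * b'" by blast
    then have "odd a'" using 3 by auto
    show thesis
    \<comment> \<open>Half of \<open>\<theta>\<^sup>2\<close> is integral because 2 divides
      \<open>a\<close> and 4 divides \<open>b\<close>; \<open>c1 + c2\<close> is odd because
      \<open>a'\<close> is odd.\<close>
    proof (rule found[of 0 "1/2" "- a" "a'\<^sup>2" "- 2 * b'\<^sup>2"])
      show "of_int (- a) = tr1 0 (1/2)" "of_int (a'\<^sup>2) = tr2 0 (1/2)" "of_int (- 2 * b'\<^sup>2) = tr3 0 (1/2)"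
        unfolding tr1_def tr2_def tr3_def unfolding ab by (simp_all add: power2_eq_square power3_eq_cube)
    qed (use \<open>odd a'\<close> in \<open>simp_all add: ab\<close>)
  qed
qed

lemma three_dvd_value_gcd:
  assumes "4 * a ^ 3 - 27 * b\<^sup>2 = 3 ^ s * \<Delta>3"
    and "[a = 1] (mod 3) \<and> 3 dvd b \<or> [a = 3] (mod 9) \<and> s > 6 \<and> even s \<and> [\<Delta>3 = 1] (mod 3)"
  obtains \<eta> where "\<eta> \<in> primitive_integers K" "3 dvd value_gcd K \<eta>"
proof (cases "[a = 1] (mod 3) \<and> 3 dvd b")
  case True
  have "(1::rat) \<noteq> 0 \<or> (0::rat) \<noteq> 0" "of_int 0 = tr1 1 0" "of_int (- a) = tr2 1 0" "of_int b = tr3 1 0"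
    by (simp_all add: tr1_def tr2_def tr3_def)
  note prim = primitive_integer_elt[OF this]
  have "[- a = - 1] (mod 3)" using True by (simp add: cong_minus_minus_iff)
  then have "3 dvd value_gcd K (elt 0 1 0)"
    unfolding value_gcd_def prim(2) dvd_cubic_values_iff using True by simp
  then show ?thesis by (rule that[OF prim(1)])
next
  case False
  then have "[a = 3] (mod 9)" "s > 6" "even s" "[\<Delta>3 = 1] (mod 3)" using assms(2) by auto
  from split_witness[OF assms(1) this(3,2,4,1)]
  obtain \<rho> N D c0 c1 e :: int where w: "N \<noteq> 0" "D \<noteq> 0" "3 * \<rho>\<^sup>2 - a = 3 * N * e"
    "\<rho> ^ 3 - a * \<rho> + b = N * D" "3 * \<rho> * D = N * c1" "D\<^sup>2 = N * c0" "3 dvd c0" "[c1 = - 1] (mod 3)" .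
  let ?i = "of_int :: int \<Rightarrow> 'a"
  define X where "X = \<theta> - ?i \<rho>"
  have X: "X = elt (- of_int \<rho>) 1 0" by (simp add: X_def elt_def of_rat_minus)
  have X0: "X \<noteq> 0" unfolding X elt_eq_0_iff by simp
  define t where "t = - ?i D / X"
  have tX: "t * X = - ?i D" using X0 by (simp add: t_def)
  have t0: "t \<noteq> 0" using X0 w by (simp add: t_def)
  have w': "3 * (?i \<rho>)\<^sup>2 - ?i a = 3 * ?i N * ?i e" "(?i \<rho>) ^ 3 - ?i a * ?i \<rho> + ?i b = ?i N * ?i D"
    "3 * ?i \<rho> * ?i D = ?i N * ?i c1" "(?i D)\<^sup>2 = ?i N * ?i c0"
    using w(3-6)[THEN arg_cong[of _ _ ?i]] by simp_all
  have "\<theta> = X + ?i \<rho>" by (simp add: X_def)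
  then have "X ^ 3 + 3 * ?i \<rho> * X\<^sup>2 + (3 * (?i \<rho>)\<^sup>2 - ?i a) * X + ((?i \<rho>) ^ 3 - ?i a * ?i \<rho> + ?i b) = 0"
    using root by (simp add: algebra_simps power2_eq_square power3_eq_cube)
  then have eqX: "X ^ 3 + 3 * ?i \<rho> * X\<^sup>2 + 3 * ?i N * ?i e * X + ?i N * ?i D = 0" unfolding w' .
  \<comment> \<open>Multiplied by \<open>N * X ^ 3\<close>, the cubic in \<open>t\<close> can be
    written with \<open>t * X = - D\<close>, and becomes \<open>- D\<^sup>2\<close> times the cubic
    equation of \<open>X\<close>.\<close>
  have "?i N * X ^ 3 * (t ^ 3 - 3 * ?i e * t\<^sup>2 + ?i c1 * t - ?i c0)
      = ?i N * (t * X) ^ 3 - 3 * ?i N * ?i e * (t * X)\<^sup>2 * X + (?i N * ?i c1) * (t * X) * X\<^sup>2 - (?i N * ?i c0) * X ^ 3"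
    by (simp add: algebra_simps power2_eq_square power3_eq_cube)
  also have "\<dots> = - (?i D)\<^sup>2 * (X ^ 3 + 3 * ?i \<rho> * X\<^sup>2 + 3 * ?i N * ?i e * X + ?i N * ?i D)"
    unfolding tX w'(3,4)[symmetric] by (simp add: algebra_simps power2_eq_square power3_eq_cube)
  also have "\<dots> = 0" unfolding eqX by simp
  finally have "t ^ 3 - 3 * ?i e * t\<^sup>2 + ?i c1 * t - ?i c0 = 0" using w(1) X0 by simp
  then have eqt: "t ^ 3 + ?i (- 3 * e) * t\<^sup>2 + ?i c1 * t + ?i (- c0) = 0" by simp
  have "t \<in> K"
    unfolding t_def X by (intro is_subfieldD[OF subfield_K] is_subfield_of_int[OF subfield_K] elt_in_K)
  moreover have "\<theta> = ?i \<rho> - ?i D / t" using t0 tX by (simp add: X_def field_simps)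
  then have "\<theta> \<in> rat_adjoin t"
    by (simp add: is_subfieldD[OF is_subfield_rat_adjoin] is_subfield_of_int[OF is_subfield_rat_adjoin] in_rat_adjoin_self)
  ultimately have prim: "t \<in> primitive_integers K" "field_char_poly K t = [:- c0, c1, - 3 * e, 1:]"
    using primitive_integerI[OF _ _ eqt] by blast+
  have "3 dvd value_gcd K t"
    unfolding value_gcd_def prim(2) dvd_cubic_values_iff using w(7,8) by simp
  then show ?thesis using that prim(1) by blast
qed

section \<open>Consequences of divisibility by 2 or 3\<close>

lemma two_dvd_value_gcdD:
  assumes "\<eta> \<in> primitive_integers K" "2 dvd value_gcd K \<eta>"
  shows "\<exists>y. 2 ^ k dvd y ^ 3 - a * y + b"
proof -
  obtain p q r c0 c1 c2 where *: "q \<noteq> 0 \<or> r \<noteq> 0" "field_char_poly K \<eta> = [:c0, c1, c2, 1:]"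
    "char_cubic p q r = map_poly of_int [:c0, c1, c2, 1:]"
    using primitive_integer_char_poly[OF assms(1)] .
  have c: "even c0" "odd (c1 + c2)"
    using assms(2) unfolding value_gcd_def *(2) dvd_cubic_values_iff by auto
  \<comment> \<open>Both residues are roots modulo 2; the derivative is \<open>n + c1\<close> modulo
    2, so this \<open>n\<close> is a simple one.\<close>
  define n :: int where "n = (if odd c1 then 0 else 1)"
  show ?thesis
    by (rule padic_root_exists[OF *(1,3), of 2 n]) (use c in \<open>auto simp: n_def\<close>)
qed

text \<open>Modulo 3 the characteristic polynomial is \<open>x ^ 3 - x\<close>: its simple root 0
  can be lifted, and its discriminant 1 can be compared with that of \<theta>.\<close>

lemma three_dvd_value_gcdD:
  assumes "\<eta> \<in> primitive_integers K" "3 dvd value_gcd K \<eta>"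
    and \<Delta>: "4 * a ^ 3 - 27 * b\<^sup>2 = 3 ^ s * \<Delta>3" "\<not> 3 dvd \<Delta>3"
  shows "\<exists>y. 3 ^ k dvd y ^ 3 - a * y + b" "even s" "[\<Delta>3 = 1] (mod 3)"
proof -
  obtain p q r c0 c1 c2 where *: "q \<noteq> 0 \<or> r \<noteq> 0" "field_char_poly K \<eta> = [:c0, c1, c2, 1:]"
    "char_cubic p q r = map_poly of_int [:c0, c1, c2, 1:]"
    using primitive_integer_char_poly[OF assms(1)] .
  have c: "3 dvd c0" "3 dvd c2" "[c1 = - 1] (mod 3)"
    using assms(2) unfolding value_gcd_def *(2) dvd_cubic_values_iff by auto
  have "\<not> 3 dvd c1" using c(3) cong_dvd_iff[of c1 "- 1" 3] by auto
  then show "\<exists>y. 3 ^ k dvd y ^ 3 - a * y + b"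
    by (intro padic_root_exists[OF *(1,3), of 3 0]) (use c in auto)
  define d where "d = c2\<^sup>2 * c1\<^sup>2 - 4 * c1 ^ 3 - 4 * c2 ^ 3 * c0 - 27 * c0\<^sup>2 + 18 * c2 * c1 * c0"
  define I where "I = index_form q r"
  have "I \<noteq> 0" unfolding I_def by (rule index_form_nonzero[OF *(1)])
  obtain u v where uv: "I = of_int u / of_int v" "v > 0"
    by (metis quotient_of_denom_pos quotient_of_div surj_pair)
  have "of_int d = I\<^sup>2 * of_int (3 ^ s * \<Delta>3)"
    using char_cubic_disc[of p q r "of_int c0" "of_int c1" "of_int c2"] *(3)
    unfolding \<Delta>(1)[symmetric] I_def d_def by (simp add: hom_distribs)
  then have "of_int (v\<^sup>2 * d) = (of_int (u\<^sup>2 * (3 ^ s * \<Delta>3)) :: rat)"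
    using uv by (simp add: power_divide)
  then have eq: "v\<^sup>2 * d = u\<^sup>2 * (3 ^ s * \<Delta>3)" by (simp only: of_int_eq_iff)
  have "[d = 0\<^sup>2 * c1\<^sup>2 - 1 * (- 1) ^ 3 - 4 * 0 ^ 3 * 0 - 0 * 0\<^sup>2 + 0 * 0 * c1 * 0] (mod 3)"
    unfolding d_def using c
    by (intro cong_add cong_diff cong_mult cong_pow cong_refl) (simp_all add: cong_0_iff cong_def)
  then have d1: "[d = 1] (mod 3)" by simp
  have "u \<noteq> 0" using \<open>I \<noteq> 0\<close> uv by auto
  from square_ratio_mod_3[OF eq this _ d1 refl \<Delta>(2)] uv(2)
  show "even s" "[\<Delta>3 = 1] (mod 3)" by auto
qed

lemma value_gcd_dvd_6:
  assumes "\<eta> \<in> primitive_integers K"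
  shows "value_gcd K \<eta> dvd 6"
  using primitive_integer_char_poly[OF assms] cubic_value_gcd_dvd_6 unfolding value_gcd_def by metis

end

section \<open>Valuations as divisibility, and the least common multiple\<close>

lemma vp_less_iff:
  assumes "prime p"
  shows "vp p m < enat k \<longleftrightarrow> \<not> int p ^ k dvd m"
proof (cases "m = 0")
  case False
  have "\<not> is_unit (int p)" using assms by auto
  then have "int p ^ k dvd m \<longleftrightarrow> k \<le> multiplicity (int p) m"
    using False by (rule power_dvd_iff_le_multiplicity[OF _ , rotated])
  then show ?thesis using False by (simp add: vp_def not_le)
qed (simp add: vp_def)

theorem theorem1p2:
  fixes a b \<Delta> \<Delta>\<^sub>3 :: int
    and \<theta> :: "'a::field_char_0"
    and K :: "'a set"
    and s\<^sub>3 \<alpha> \<beta> :: nat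
  assumes "irreducible ([:of_int b, - of_int a, 0, 1:] :: rat poly)"
    and "\<And>p::nat. prime p \<Longrightarrow> vp p a < 2 \<or> vp p b < 3"
    and "\<theta> ^ 3 - of_int a * \<theta> + of_int b = 0"
    and "K = rat_adjoin \<theta>"
    and "\<Delta> = 4 * a ^ 3 - 27 * b ^ 2"
    and "enat s\<^sub>3 = vp 3 \<Delta>"
    and "\<Delta> = 3 ^ s\<^sub>3 * \<Delta>\<^sub>3"
    and "\<alpha> = (if (vp 2 a = 1 \<and> vp 2 a < vp 2 b) \<or> \<not> [a = b] (mod 2) then 1 else 0)"
    and "\<beta> = (if ([a = 3] (mod 9) \<and> [b ^ 2 = a + 1] (mod 27) \<and> s\<^sub>3 > 6 \<and> even s\<^sub>3 \<and> [\<Delta>\<^sub>3 = 1] (mod 3))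
                 \<or> ([a = 1] (mod 3) \<and> 3 dvd b)
               then 1 else 0)"
  shows "field_value_lcm K = 2 ^ \<alpha> * 3 ^ \<beta>"
proof -
  interpret cubic_field a b \<theta> K by unfold_locales (use assms in auto)
  have min: "\<not> (int p ^ 2 dvd a \<and> int p ^ 3 dvd b)" if "prime p" for p
    using assms(2)[OF that] vp_less_iff[OF that, of a 2] vp_less_iff[OF that, of b 3]
    by (auto simp: numeral_eq_enat)
  \<comment> \<open>\<open>enat s\<^sub>3\<close> is finite, so \<Delta> is nonzero and
    \<open>s\<^sub>3\<close> is its exact exponent at 3.\<close>
  have \<Delta>3: "\<not> 3 dvd \<Delta>\<^sub>3"
  proof
    assume "3 dvd \<Delta>\<^sub>3"
    then have "int 3 ^ Suc s\<^sub>3 dvd \<Delta>" unfolding assms(7) by (simp add: mult.commute)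
    then have "\<not> vp 3 \<Delta> < enat (Suc s\<^sub>3)" using vp_less_iff[of 3 \<Delta> "Suc s\<^sub>3"] by simp
    then show False unfolding assms(6)[symmetric] by simp
  qed
  have D: "4 * a ^ 3 - 27 * b\<^sup>2 = 3 ^ s\<^sub>3 * \<Delta>\<^sub>3" using assms(5,7) by simp
  have vp2: "vp 2 a = 1 \<and> vp 2 a < vp 2 b \<longleftrightarrow> even a \<and> \<not> 4 dvd a \<and> 4 dvd b"
  proof -
    have *: "vp 2 m < 1 \<longleftrightarrow> odd m" "vp 2 m < 2 \<longleftrightarrow> \<not> 4 dvd m" for m
      using vp_less_iff[of 2 m 1] vp_less_iff[of 2 m 2] by (simp_all add: one_enat_def numeral_eq_enat)
    have "vp 2 a = 1 \<longleftrightarrow> \<not> vp 2 a < 1 \<and> vp 2 a < 2"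
      by (cases "vp 2 a") (auto simp: one_enat_def numeral_eq_enat)
    moreover have "(1 < vp 2 b) \<longleftrightarrow> \<not> vp 2 b < 2"
      by (cases "vp 2 b") (auto simp: one_enat_def numeral_eq_enat)
    ultimately show ?thesis unfolding * by (metis *)
  qed
  have cong2: "[a = b] (mod 2) \<longleftrightarrow> even (a + b)" by (simp add: cong_def) presburger
  have two: "\<not> 2 dvd value_gcd K \<eta>" if "\<alpha> = 0" "\<eta> \<in> primitive_integers K" for \<eta>
  proof
    assume "2 dvd value_gcd K \<eta>"
    then have "\<exists>y. 2 ^ 3 dvd y ^ 3 - a * y + b" by (rule two_dvd_value_gcdD[OF that(2)])
    then obtain y where "2 ^ 3 dvd y ^ 3 - a * y + b" by blast
    moreover have "\<not> 8 dvd y ^ 3 - a * y + b"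
      using that(1) min[of 2] unfolding assms(8) vp2 cong2
      by (intro no_root_mod_8) (auto split: if_splits)
    ultimately show False by simp
  qed
  have three: "\<not> 3 dvd value_gcd K \<eta>" if "\<beta> = 0" "\<eta> \<in> primitive_integers K" for \<eta>
  proof
    assume "3 dvd value_gcd K \<eta>"
    note * = three_dvd_value_gcdD[OF that(2) this D \<Delta>3]
    obtain y where "3 ^ 4 dvd y ^ 3 - a * y + b" using *(1) by blast
    then have "81 dvd y ^ 3 - a * y + b" by simp
    from root_mod_81[OF D *(2,3) this] min[of 3] show False
      using that(1) *(2,3) unfolding assms(9) by (auto split: if_splits)
  qed
  \<comment> \<open>Each value gcd is 1, 2, 3 or 6, and a vanishing \<alpha> or \<beta> excludes the
    multiples of 2 or 3.\<close>
  have "field_value_lcm K dvd 2 ^ \<alpha> * 3 ^ \<beta>"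
    unfolding field_value_lcm_def
  proof (rule Lcm_least)
    fix x assume "x \<in> value_gcd K ` primitive_integers K"
    then obtain \<eta> where \<eta>: "\<eta> \<in> primitive_integers K" and x: "x = value_gcd K \<eta>" by blast
    have "x dvd 6" "x \<ge> 0" using value_gcd_dvd_6[OF \<eta>] by (simp_all add: x value_gcd_def)
    then have "x \<in> {0..6}" by (auto dest: zdvd_imp_le)
    then have "x \<in> {0, 1, 2, 3, 4, 5, 6}" by auto
    then have "x \<in> {1, 2, 3, 6}" using \<open>x dvd 6\<close> by auto
    moreover have "\<alpha> = 0 \<Longrightarrow> odd x" "\<beta> = 0 \<Longrightarrow> \<not> 3 dvd x" using two three \<eta> x by auto
    moreover have "\<alpha> = 0 \<or> \<alpha> = 1" "\<beta> = 0 \<or> \<beta> = 1" using assms(8,9) by auto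
    ultimately show "x dvd 2 ^ \<alpha> * 3 ^ \<beta>" by auto
  qed
  moreover have "2 ^ \<alpha> * 3 ^ \<beta> dvd field_value_lcm K"
  proof (rule divides_mult)
    have lcm: "x dvd field_value_lcm K" if "\<eta> \<in> primitive_integers K" "x dvd value_gcd K \<eta>" for x \<eta>
      unfolding field_value_lcm_def using that by (meson dvd_Lcm dvd_trans imageI)
    show "2 ^ \<alpha> dvd field_value_lcm K"
    proof (cases "\<alpha> = 0")
      case False
      then have "odd (a + b) \<or> (even a \<and> \<not> 4 dvd a \<and> 4 dvd b)"
        unfolding assms(8) vp2 cong2 by (auto split: if_splits)
      then show ?thesis using two_dvd_value_gcd lcm False assms(8) by (metis power_one_right)
    qed simp
    show "3 ^ \<beta> dvd field_value_lcm K"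
    proof (cases "\<beta> = 0")
      case False
      then have "[a = 1] (mod 3) \<and> 3 dvd b \<or> [a = 3] (mod 9) \<and> s\<^sub>3 > 6 \<and> even s\<^sub>3 \<and> [\<Delta>\<^sub>3 = 1] (mod 3)"
        unfolding assms(9) by (auto split: if_splits)
      then show ?thesis using three_dvd_value_gcd[OF D] lcm False assms(9) by (metis power_one_right)
    qed simp
    show "coprime (2 ^ \<alpha>) (3 ^ \<beta> :: int)" by simp
  qed
  moreover have "field_value_lcm K \<ge> 0" by (simp add: field_value_lcm_def)
  ultimately show ?thesis by (intro zdvd_antisym_nonneg) simp_all
qed

end
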